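(* Let $\sigma : I \to S$ be a regular $C^2$-curve on an (oriented) smooth surface $S$ and let $p$ be a point on $\sigma(I)$. Then the geodesic curvature $\kappa(p)$ of $\sigma$ at $p$ can be obtained as a limit of the discrete geodesic curvatures of geodesic V-lines $\{p_1,p,p_2\}$ inscribed on the curve, i.e. $$\lim_{\substack{p_1,p_2\to p\\ p_1,p_2\in\sigma(I)}}\ \kappa_g(p_1,p,p_2)=\kappa(p).$$
   Context: Let $\mathbf n:S\to\mathbb{S}^2$ be the Gauss map of the oriented surface $S$. If $\sigma$ is parametrized by arc length, its geodesic curvature at $p=\sigma(t)$ is $$\kappa(p)=\langle \ddot\sigma(t),\ \mathbf n(p)\wedge\dot\sigma(t)\rangle=\Big\langle \tfrac{D\dot\sigma}{dt}(t),\ \mathbf n(p)\wedge\dot\sigma(t)\Big\rangle,$$ where $\frac{D}{dt}$ is the covariant derivative on $S$ and $\wedge$ is the cross product. A geodesic V-line $\{p_1,p,p_2\}$ on $S$ is made of two geodesics $c_1$ and $c_2$ of $S$, connecting respectively $p_1$ to $p$ and $p$ to $p_2$. Let $l_i$ be the length of $c_i$ and let $u_i$ be the tangent vector of $c_i$ at $p$. The geodesic angular defect is the (signed) angle $\delta=\sphericalangle(u_1,u_2)$ in $T_pS$, oriented by $\mathbf n(p)$. The discrete geodesic curvature of the V-line at $p$ is $$\kappa_g(p_1,p,p_2)=\frac{2\delta}{l_1+l_2}.$$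
   Formalization: The limit is over V-lines whose geodesics have lengths tending to 0, with p1 and p2 on opposite sides of p in the curve's order, their parameters tending to that of p (I open); long geodesics (great circles on a sphere), p1, p2 on one side, or self-intersections break the literal claim. *)

theory Defs
  imports "HOL-Analysis.Analysis"
begin

section \<open>Oriented smooth surfaces in Euclidean 3-space\<close>

text \<open>Intended for open \<open>U\<close>; the derivatives in the successor step are all directional
  derivatives, so this is the usual notion of a \<open>C\<^sup>k\<close> map.\<close>

primrec Ck_on :: "nat \<Rightarrow> 'a::euclidean_space set \<Rightarrow> ('a \<Rightarrow> 'b::real_normed_vector) \<Rightarrow> bool" where
  "Ck_on 0 U f \<longleftrightarrow> continuous_on U f"
| "Ck_on (Suc k) U f \<longleftrightarrow> (\<forall>x\<in>U. f differentiable (at x)) \<and>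
     (\<forall>v. Ck_on k U (\<lambda>x. frechet_derivative f (at x) v))"

definition smooth_on :: "'a::euclidean_space set \<Rightarrow> ('a \<Rightarrow> 'b::real_normed_vector) \<Rightarrow> bool" where
  "smooth_on U f \<longleftrightarrow> (\<forall>k. Ck_on k U f)"

text \<open>An embedded 2-dimensional submanifold without boundary: near each of its points, \<open>S\<close> is
  carried to a piece of a coordinate plane by a diffeomorphism between open subsets of the
  ambient space.\<close>

definition smooth_surface :: "(real^3) set \<Rightarrow> bool" where
  "smooth_surface S \<longleftrightarrow> (\<forall>p\<in>S. \<exists>V W (\<phi> :: real^3 \<Rightarrow> real^3) \<psi>.
     open V \<and> p \<in> V \<and> open W \<and> homeomorphism V W \<phi> \<psi> \<and> smooth_on V \<phi> \<and> smooth_on W \<psi> \<and>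
     \<phi> ` (S \<inter> V) = {y \<in> W. y $ 3 = 0})"

definition tangent_space :: "(real^3) set \<Rightarrow> real^3 \<Rightarrow> (real^3) set" where
  "tangent_space S p = {v. \<exists>(c :: real \<Rightarrow> real^3) e. e > 0 \<and> c ` {-e<..<e} \<subseteq> S \<and> c 0 = p \<and>
     (c has_vector_derivative v) (at 0)}"

text \<open>A continuous unit normal field is automatically smooth, so nothing more is required of the
  Gauss map.\<close>

definition gauss_map :: "(real^3) set \<Rightarrow> (real^3 \<Rightarrow> real^3) \<Rightarrow> bool" where
  "gauss_map S n \<longleftrightarrow> continuous_on S n \<and>
     (\<forall>p\<in>S. norm (n p) = 1 \<and> (\<forall>v\<in>tangent_space S p. n p \<bullet> v = 0))"

section \<open>Curves and geodesic curvature\<close>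

text \<open>Derivatives are taken within the parameter interval \<open>A\<close>, hence one-sided at those end points
  that belong to \<open>A\<close>.\<close>

definition velocity :: "real set \<Rightarrow> (real \<Rightarrow> real^3) \<Rightarrow> real \<Rightarrow> real^3" where
  "velocity A c u = vector_derivative c (at u within A)"

definition regular_C2_curve :: "real set \<Rightarrow> (real \<Rightarrow> real^3) \<Rightarrow> bool" where
  "regular_C2_curve A c \<longleftrightarrow>
     (\<forall>u\<in>A. c differentiable (at u within A)) \<and>
     (\<forall>u\<in>A. velocity A c differentiable (at u within A)) \<and>
     continuous_on A (velocity A (velocity A c)) \<and>
     (\<forall>u\<in>A. velocity A c u \<noteq> 0)"

definition geodesic_curvature_arclength ::
    "(real^3 \<Rightarrow> real^3) \<Rightarrow> real set \<Rightarrow> (real \<Rightarrow> real^3) \<Rightarrow> real \<Rightarrow> real" where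
  "geodesic_curvature_arclength n J \<tau> s =
     velocity J (velocity J \<tau>) s \<bullet> cross3 (n (\<tau> s)) (velocity J \<tau> s)"

text \<open>Signed arc length measured from the parameter \<open>t\<close>: for each \<open>u \<noteq> t\<close> exactly one of the two
  integrals is over a non-empty interval.\<close>

definition signed_arc_length :: "real set \<Rightarrow> (real \<Rightarrow> real^3) \<Rightarrow> real \<Rightarrow> real \<Rightarrow> real" where
  "signed_arc_length I \<sigma> t u =
     integral {t..u} (\<lambda>x. norm (velocity I \<sigma> x)) - integral {u..t} (\<lambda>x. norm (velocity I \<sigma> x))"

text \<open>The geodesic curvature of a regular curve at the parameter \<open>t\<close> is that of its
  reparametrization by arc length; the parameter \<open>t\<close> corresponds to arc length \<open>0\<close>.\<close>

definition geodesic_curvature ::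
    "(real^3 \<Rightarrow> real^3) \<Rightarrow> real set \<Rightarrow> (real \<Rightarrow> real^3) \<Rightarrow> real \<Rightarrow> real" where
  "geodesic_curvature n I \<sigma> t =
     geodesic_curvature_arclength n (signed_arc_length I \<sigma> t ` I)
       (\<sigma> \<circ> inv_into I (signed_arc_length I \<sigma> t)) 0"

section \<open>Geodesic V-lines\<close>

text \<open>The covariant derivative of a tangent field \<open>w\<close> along \<open>c\<close> is the tangential part of its
  derivative.\<close>

definition covariant_derivative :: "(real^3 \<Rightarrow> real^3) \<Rightarrow> real set \<Rightarrow> (real \<Rightarrow> real^3) \<Rightarrow>
    (real \<Rightarrow> real^3) \<Rightarrow> real \<Rightarrow> real^3" where
  "covariant_derivative n A c w u =
     velocity A w u - (velocity A w u \<bullet> n (c u)) *\<^sub>R n (c u)"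

text \<open>All geodesic arcs are parametrized on the unit interval, with constant but otherwise
  arbitrary speed.\<close>

definition geodesic_arc :: "(real^3) set \<Rightarrow> (real^3 \<Rightarrow> real^3) \<Rightarrow> (real \<Rightarrow> real^3) \<Rightarrow> bool" where
  "geodesic_arc S n c \<longleftrightarrow> c ` {0..1} \<subseteq> S \<and> regular_C2_curve {0..1} c \<and>
     (\<forall>u\<in>{0..1}. covariant_derivative n {0..1} c (velocity {0..1} c) u = 0)"

definition arc_len :: "(real \<Rightarrow> real^3) \<Rightarrow> real" where
  "arc_len c = integral {0..1} (\<lambda>u. norm (velocity {0..1} c u))"

definition geodesic_V_line :: "(real^3) set \<Rightarrow> (real^3 \<Rightarrow> real^3) \<Rightarrow> real^3 \<Rightarrow> real^3 \<Rightarrow> real^3 \<Rightarrow>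
    (real \<Rightarrow> real^3) \<Rightarrow> (real \<Rightarrow> real^3) \<Rightarrow> bool" where
  "geodesic_V_line S n p1 p p2 c1 c2 \<longleftrightarrow>
     geodesic_arc S n c1 \<and> c1 0 = p1 \<and> c1 1 = p \<and>
     geodesic_arc S n c2 \<and> c2 0 = p \<and> c2 1 = p2"

text \<open>For non-zero \<open>u\<close> and \<open>v\<close> orthogonal to the unit vector \<open>m\<close>: the angle in \<open>(-\<pi>, \<pi>]\<close> of the
  rotation about \<open>m\<close> that takes the direction of \<open>u\<close> to the direction of \<open>v\<close>.\<close>

definition signed_angle :: "real^3 \<Rightarrow> real^3 \<Rightarrow> real^3 \<Rightarrow> real" where
  "signed_angle m u v = (THE \<delta>. -pi < \<delta> \<and> \<delta> \<le> pi \<and>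
     v /\<^sub>R norm v = cos \<delta> *\<^sub>R (u /\<^sub>R norm u) + sin \<delta> *\<^sub>R cross3 m (u /\<^sub>R norm u))"

definition discrete_geodesic_curvature ::
    "(real^3 \<Rightarrow> real^3) \<Rightarrow> (real \<Rightarrow> real^3) \<Rightarrow> (real \<Rightarrow> real^3) \<Rightarrow> real" where
  "discrete_geodesic_curvature n c1 c2 =
     2 * signed_angle (n (c1 1)) (velocity {0..1} c1 1) (velocity {0..1} c2 0) /
       (arc_len c1 + arc_len c2)"

text \<open>V-lines inscribed on \<open>\<sigma>\<close> with vertex \<open>\<sigma> t\<close>. The curve runs through \<open>p1\<close>, \<open>p\<close>, \<open>p2\<close> in this
  order: the sign of the angular defect depends on it, and with \<open>p1\<close> and \<open>p2\<close> on the same side of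
  \<open>p\<close> the defect would tend to \<open>\<pi>\<close> in absolute value.\<close>

definition inscribed_V_lines :: "(real^3) set \<Rightarrow> (real^3 \<Rightarrow> real^3) \<Rightarrow> real set \<Rightarrow>
    (real \<Rightarrow> real^3) \<Rightarrow> real \<Rightarrow> (real \<times> real \<times> (real \<Rightarrow> real^3) \<times> (real \<Rightarrow> real^3)) set" where
  "inscribed_V_lines S n I \<sigma> t = {(s1, s2, c1, c2). s1 \<in> I \<and> s2 \<in> I \<and> s1 < t \<and> t < s2 \<and>
     geodesic_V_line S n (\<sigma> s1) (\<sigma> t) (\<sigma> s2) c1 c2}"

text \<open>Inscribed V-lines shrinking to their vertex. The parameters of \<open>p1\<close> and \<open>p2\<close> tend to \<open>t\<close>,
  which singles out the branch of a possibly self-intersecting curve, and the geodesics become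
  short, which rules out e.g. complementary great-circle arcs on a sphere.\<close>

definition shrinking_V_lines :: "(real^3) set \<Rightarrow> (real^3 \<Rightarrow> real^3) \<Rightarrow> real set \<Rightarrow>
    (real \<Rightarrow> real^3) \<Rightarrow> real \<Rightarrow> (real \<times> real \<times> (real \<Rightarrow> real^3) \<times> (real \<Rightarrow> real^3)) filter" where
  "shrinking_V_lines S n I \<sigma> t =
     inf (filtercomap (\<lambda>(s1, s2, c1, c2). (s1, s2, arc_len c1, arc_len c2)) (nhds (t, t, 0, 0)))
         (principal (inscribed_V_lines S n I \<sigma> t))"

end

theory Submission
  imports Defs
begin

text \<open>
  The limit formula compares, in the tangent plane at \<open>p = \<sigma> t\<close>, the second-order Taylor expansion of
  the curve with that of the two geodesics. The acceleration of a geodesic is normal to the surface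
  everywhere along the geodesic, and it is bounded by a constant times the squared length. Since the
  Gauss map is continuous, the component of this acceleration tangential at \<open>p\<close> is of smaller order.
  Hence the chord of a short geodesic arc, projected to the tangent plane, is its velocity vector at
  \<open>p\<close> up to an error \<open>o(length\<^sup>2)\<close> (lemma \<open>short_geodesic_chord\<close>). The same chord is a chord of the
  curve, whose expansion is \<open>h a + h\<^sup>2 b / 2 + o(h\<^sup>2)\<close> with velocity \<open>a\<close> and acceleration \<open>b\<close>.
  So the velocities of the two geodesics at \<open>p\<close> are known to second order in the parameter
  distances \<open>h1\<close> and \<open>h2\<close>. The sine of the angle between them is
  \<open>(h1 + h2) (b \<bullet> (n \<times> a)) / (2 |a|\<^sup>2)\<close> up to \<open>o(h1 + h2)\<close>, and the total length is
  \<open>(h1 + h2) |a| + o(h1 + h2)\<close>. Therefore twice the quotient tends to \<open>b \<bullet> (n \<times> a) / |a|\<^sup>3\<close>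
  (lemma \<open>signed_angle_over_length_limit\<close>), which is the geodesic curvature in an arbitrary regular
  parametrization (lemma \<open>geodesic_curvature_eq\<close>).

  That short inscribed V-lines exist is proved without an exponential map. Locally the surface is a
  level set \<open>F = 0\<close>, and there is a second-order equation in the ambient space that forces \<open>c''\<close> to
  be parallel to the gradient of \<open>F\<close> and \<open>(F \<circ> c)'' = 0\<close>. Its right-hand side is quadratic in the
  velocity, so the two-point boundary value problem for nearby points is solved by a contraction
  (lemma \<open>quadratic_boundary_value_problem\<close>). If both end points lie on the surface, then \<open>F \<circ> c\<close> is
  affine with zero boundary values, so the solution lies on the surface and is a geodesic (lemma
  \<open>short_geodesics_exist\<close>).
\<close>

section \<open>A boundary value problem with quadratic right-hand side\<close>

lemma increment_bound_vector_derivative: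
  fixes f :: "real \<Rightarrow> 'a::real_normed_vector"
  assumes "\<And>x. x \<in> A \<Longrightarrow> (f has_vector_derivative f' x) (at x within A)" "convex A"
    and "\<And>x. x \<in> A \<Longrightarrow> norm (f' x) \<le> B" "a \<in> A" "b \<in> A"
  shows "norm (f b - f a) \<le> B * \<bar>b - a\<bar>"
  using differentiable_bound[OF assms(2), of f "\<lambda>x h. h *\<^sub>R f' x" B b a] assms
  by (auto simp: has_vector_derivative_def onorm_scaleR_left onorm_id real_norm_def)

text \<open>The function \<open>dirichlet w\<close> solves \<open>c'' = w\<close> with \<open>c 0 = c 1 = 0\<close>, and \<open>dirichlet_slope w\<close> is its
  derivative; the constant subtracted from the antiderivative of \<open>w\<close> is what makes the value at \<open>1\<close>
  vanish. Iterated integrals are preferred to a Green kernel because both derivatives then come from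
  the fundamental theorem of calculus, and both sup norms are at most twice that of \<open>w\<close>.\<close>

definition dirichlet_slope :: "(real \<Rightarrow> 'a::banach) \<Rightarrow> real \<Rightarrow> 'a" where
  "dirichlet_slope w s = integral {0..s} w - integral {0..1} (\<lambda>u. integral {0..u} w)"

definition dirichlet :: "(real \<Rightarrow> 'a::banach) \<Rightarrow> real \<Rightarrow> 'a" where
  "dirichlet w s = integral {0..s} (dirichlet_slope w)"

lemma dirichlet_slope_has_derivative:
  assumes "continuous_on {0..1} w" "s \<in> {0..1}"
  shows "(dirichlet_slope w has_vector_derivative w s) (at s within {0..1})"
  unfolding dirichlet_slope_def
  using integral_has_vector_derivative[OF assms] by (auto intro!: derivative_eq_intros)

lemma dirichlet_slope_continuous:
  assumes "continuous_on {0..1} w"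
  shows "continuous_on {0..1} (dirichlet_slope w)"
  using dirichlet_slope_has_derivative[OF assms]
  by (meson continuous_on_eq_continuous_within has_vector_derivative_continuous)

lemma dirichlet_has_derivative:
  assumes "continuous_on {0..1} w" "s \<in> {0..1}"
  shows "(dirichlet w has_vector_derivative dirichlet_slope w s) (at s within {0..1})"
  unfolding dirichlet_def
  using integral_has_vector_derivative[OF dirichlet_slope_continuous assms(2)] assms(1) by auto

lemma indefinite_integral_continuous:
  fixes w :: "real \<Rightarrow> 'a::banach"
  assumes "continuous_on {0..1} w"
  shows "continuous_on {0..1} (\<lambda>u. integral {0..u} w)"
  by (intro indefinite_integral_continuous_1 integrable_continuous_real assms)

lemma dirichlet_0: "dirichlet w 0 = 0"
  by (simp add: dirichlet_def)

lemma dirichlet_1: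
  assumes "continuous_on {0..1} w"
  shows "dirichlet w 1 = 0"
proof -
  have "integral {0..1} (\<lambda>s. integral {0..s} w - integral {0..1} (\<lambda>u. integral {0..u} w)) =
      integral {0..1} (\<lambda>s. integral {0..s} w)
      - integral {0..1} (\<lambda>s::real. integral {0..1} (\<lambda>u. integral {0..u} w))"
    by (intro Henstock_Kurzweil_Integration.integral_diff integrable_continuous_real
        indefinite_integral_continuous assms continuous_on_const)
  then show ?thesis
    by (simp add: dirichlet_def dirichlet_slope_def [abs_def])
qed

lemma indefinite_integral_bound:
  fixes w :: "real \<Rightarrow> 'a::banach"
  assumes "continuous_on {0..1} w" "\<And>s. s \<in> {0..1} \<Longrightarrow> norm (w s) \<le> B" "s \<in> {0..1}"
  shows "norm (integral {0..s} w) \<le> B"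
proof -
  have "norm (integral {0..s} w) \<le> B * (s - 0)"
    by (rule integral_bound) (use assms in \<open>auto intro: continuous_on_subset\<close>)
  also have "\<dots> \<le> B * 1"
    using order_trans[OF norm_ge_zero assms(2)[of 0]] assms(3) by (intro mult_left_mono) auto
  finally show ?thesis by simp
qed

lemma dirichlet_slope_bound:
  assumes "continuous_on {0..1} w" "\<And>s. s \<in> {0..1} \<Longrightarrow> norm (w s) \<le> B" "s \<in> {0..1}"
  shows "norm (dirichlet_slope w s) \<le> 2 * B"
proof -
  have "norm (integral {0..1} (\<lambda>u. integral {0..u} w)) \<le> B"
    by (rule indefinite_integral_bound[OF indefinite_integral_continuous])
       (use assms in \<open>auto intro!: indefinite_integral_bound\<close>)
  moreover have "norm (integral {0..s} w) \<le> B"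
    by (rule indefinite_integral_bound) fact+
  ultimately show ?thesis
    unfolding dirichlet_slope_def by (smt (verit) norm_triangle_ineq4)
qed

lemma dirichlet_bound:
  assumes "continuous_on {0..1} w" "\<And>s. s \<in> {0..1} \<Longrightarrow> norm (w s) \<le> B" "s \<in> {0..1}"
  shows "norm (dirichlet w s) \<le> 2 * B"
  unfolding dirichlet_def
  by (rule indefinite_integral_bound[OF dirichlet_slope_continuous])
     (use assms in \<open>auto intro: dirichlet_slope_bound\<close>)

lemma dirichlet_slope_diff:
  assumes "continuous_on {0..1} v" "continuous_on {0..1} w" "s \<in> {0..1}"
  shows "dirichlet_slope (\<lambda>u. v u - w u) s = dirichlet_slope v s - dirichlet_slope w s"
proof -
  have *: "integral {0..u} (\<lambda>u. v u - w u) = integral {0..u} v - integral {0..u} w" if "u \<in> {0..1}" for u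
    by (rule Henstock_Kurzweil_Integration.integral_diff; rule integrable_continuous_real)
       (use assms that in \<open>auto intro: continuous_on_subset\<close>)
  have "integral {0..1} (\<lambda>u. integral {0..u} (\<lambda>u. v u - w u)) =
        integral {0..1} (\<lambda>u. integral {0..u} v - integral {0..u} w)"
    by (rule Henstock_Kurzweil_Integration.integral_cong) (use * in auto)
  also have "\<dots> = integral {0..1} (\<lambda>u. integral {0..u} v) - integral {0..1} (\<lambda>u. integral {0..u} w)"
    by (intro Henstock_Kurzweil_Integration.integral_diff integrable_continuous_real
        indefinite_integral_continuous assms)
  finally show ?thesis using *[OF assms(3)] by (simp add: dirichlet_slope_def)
qed

lemma dirichlet_diff:
  assumes "continuous_on {0..1} v" "continuous_on {0..1} w" "s \<in> {0..1}"
  shows "dirichlet (\<lambda>u. v u - w u) s = dirichlet v s - dirichlet w s"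
proof -
  have "dirichlet (\<lambda>u. v u - w u) s = integral {0..s} (\<lambda>u. dirichlet_slope v u - dirichlet_slope w u)"
    unfolding dirichlet_def
    by (rule Henstock_Kurzweil_Integration.integral_cong) (use assms in \<open>auto intro!: dirichlet_slope_diff\<close>)
  also have "\<dots> = dirichlet v s - dirichlet w s"
    unfolding dirichlet_def
    by (rule Henstock_Kurzweil_Integration.integral_diff; rule integrable_continuous_real)
       (use assms in \<open>auto intro: continuous_on_subset[OF dirichlet_slope_continuous]\<close>)
  finally show ?thesis .
qed

text \<open>The estimate is the one satisfied by a map that is quadratic in the velocity with coefficients
  that are Lipschitz in the position; it is carried around in this form because it yields both
  continuity along curves and the contraction estimate below.\<close>

lemma quadratic_lipschitz_continuous:
  fixes Q :: "'a::euclidean_space \<Rightarrow> 'a \<Rightarrow> 'a"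
  assumes QL: "\<And>x y v w. \<lbrakk>x \<in> D; y \<in> D\<rbrakk> \<Longrightarrow>
      norm (Q x v - Q y w) \<le> L * (norm (x - y) * (norm w)\<^sup>2 + (norm v + norm w) * norm (v - w))"
    and c: "continuous_on A c" "continuous_on A c'" "c ` A \<subseteq> D"
  shows "continuous_on A (\<lambda>s. Q (c s) (c' s))"
proof (unfold continuous_on_def, intro ballI)
  fix a assume a: "a \<in> A"
  have lim: "(c \<longlongrightarrow> c a) (at a within A)" "(c' \<longlongrightarrow> c' a) (at a within A)"
    using c a by (auto simp: continuous_on_def)
  have "((\<lambda>s. L * (norm (c s - c a) * (norm (c' a))\<^sup>2 + (norm (c' s) + norm (c' a)) * norm (c' s - c' a)))
      \<longlongrightarrow> L * (norm (c a - c a) * (norm (c' a))\<^sup>2 + (norm (c' a) + norm (c' a)) * norm (c' a - c' a)))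
      (at a within A)"
    by (intro tendsto_intros lim)
  then have "((\<lambda>s. L * (norm (c s - c a) * (norm (c' a))\<^sup>2 + (norm (c' s) + norm (c' a)) * norm (c' s - c' a)))
      \<longlongrightarrow> 0) (at a within A)"
    by simp
  then have "((\<lambda>s. Q (c s) (c' s) - Q (c a) (c' a)) \<longlongrightarrow> 0) (at a within A)"
    by (rule Lim_null_comparison[rotated])
       (use c(3) a in \<open>auto simp: eventually_at_filter image_subset_iff intro!: always_eventually QL\<close>)
  then show "((\<lambda>s. Q (c s) (c' s)) \<longlongrightarrow> Q (c a) (c' a)) (at a within A)"
    using LIM_zero_iff by blast
qed

text \<open>The equation \<open>c'' = Q c c'\<close> is solved with the acceleration \<open>w\<close> as the unknown: position and velocity are recovered from it by adding the solution of the Dirichlet problem to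
  the straight segment from \<open>a\<close> to \<open>b\<close>. If \<open>r\<close> is the distance of the end points and the sup norm of
  \<open>w\<close> is at most \<open>r\<close>, then the velocities are at most \<open>3 r\<close>, so \<open>Q\<close> has size \<open>O(r\<^sup>2)\<close> and
  Lipschitz constant \<open>O(r)\<close> in \<open>w\<close>. For small \<open>r\<close> the substitution operator is thus a contraction of
  the ball of radius \<open>r\<close>. Its fixed point even has size \<open>O(r\<^sup>2)\<close>, hence the velocity stays
  close to \<open>b - a\<close> and does not vanish.\<close>

lemma quadratic_boundary_value_problem:
  fixes Q :: "'a::euclidean_space \<Rightarrow> 'a \<Rightarrow> 'a"
  assumes R: "0 < R" and K: "0 \<le> K"
    and Qb: "\<And>x v. x \<in> cball p R \<Longrightarrow> norm (Q x v) \<le> K * (norm v)\<^sup>2"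
    and QL: "\<And>x y v w. \<lbrakk>x \<in> cball p R; y \<in> cball p R\<rbrakk> \<Longrightarrow>
      norm (Q x v - Q y w) \<le> K * (norm (x - y) * (norm w)\<^sup>2 + (norm v + norm w) * norm (v - w))"
  obtains \<rho> where "0 < \<rho>" and "\<forall>a\<in>ball p \<rho>. \<forall>b\<in>ball p \<rho>. a \<noteq> b \<longrightarrow> (\<exists>c c'. c 0 = a \<and> c 1 = b \<and>
    (\<forall>s\<in>{0..1}. c s \<in> cball p R \<and> c' s \<noteq> 0 \<and> norm (c' s) \<le> 3 * norm (b - a) \<and>
       (c has_vector_derivative c' s) (at s within {0..1}) \<and>
       (c' has_vector_derivative Q (c s) (c' s)) (at s within {0..1})))"
proof -
  \<comment> \<open>The first bound keeps curves of length \<open>O(\<rho>)\<close> in the ball, the second one makes \<open>60 K r\<close> small,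
      which is what the contraction factor \<open>1/2\<close> needs.\<close>
  define \<rho> where "\<rho> = min (R / 7) (1 / (120 * (K + 1)))"
  have \<rho>: "0 < \<rho>" "7 * \<rho> \<le> R" "120 * (K + 1) * \<rho> \<le> 1"
    using R K by (auto simp: \<rho>_def min_def field_simps)
  show ?thesis
  proof (rule that[OF \<rho>(1)], intro ballI impI)
    fix a b assume a: "a \<in> ball p \<rho>" and b: "b \<in> ball p \<rho>" and ab: "a \<noteq> b"
    define r where "r = norm (b - a)"
    have r0: "0 < r" using ab by (simp add: r_def)
    have r2: "r < 2 * \<rho>"
      using a b norm_triangle_ineq4[of "b - p" "a - p"] by (simp add: r_def dist_norm norm_minus_commute)
    have "120 * (K + 1) * r < 120 * (K + 1) * (2 * \<rho>)"
      using r2 K by (intro mult_strict_left_mono) auto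
    then have Kr: "60 * (K * r) + 60 * r < 1" using \<rho>(3) by (simp add: algebra_simps)
    have r1: "r \<le> 1" using Kr mult_nonneg_nonneg[OF K, of r] r0 by linarith
    have Kr2: "K * r \<le> 1 / 60" using Kr r0 by linarith
    define pos where "pos w s = a + s *\<^sub>R (b - a) + dirichlet w s" for w s
    define vel where "vel w s = (b - a) + dirichlet_slope w s" for w s
    define ball_r :: "(real \<Rightarrow>\<^sub>C 'a) set" where "ball_r = cball 0 r"
    have cont: "continuous_on {0..1} (apply_bcontfun w)" for w :: "real \<Rightarrow>\<^sub>C 'a"
      by simp
    have wb: "norm (apply_bcontfun w s) \<le> r" if "w \<in> ball_r" for w s
      using norm_bounded[of w s] that by (simp add: ball_r_def)
    have vel_bound: "norm (vel w s) \<le> 3 * r" if "w \<in> ball_r" "s \<in> {0..1}" for w s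
      using dirichlet_slope_bound[OF cont wb that(2), of w] that norm_triangle_ineq[of "b - a" "dirichlet_slope w s"]
      by (simp add: vel_def r_def)
    have pos_in: "pos w s \<in> cball p R" if "w \<in> ball_r" "s \<in> {0..1}" for w s
    proof -
      have 1: "norm (s *\<^sub>R (b - a)) \<le> r"
        using that(2) r0 by (simp add: r_def[symmetric] mult_left_le_one_le)
      have "norm (pos w s - p) \<le> norm (a - p) + norm (s *\<^sub>R (b - a)) + norm (dirichlet w s)"
        unfolding pos_def
        by (metis (no_types, lifting) add_diff_eq add.commute norm_triangle_le norm_triangle_ineq add_right_mono diff_add_eq)
      also have "\<dots> \<le> \<rho> + r + 2 * r"
        using dirichlet_bound[OF cont wb that(2), of w] that(1) 1 a
        by (intro add_mono) (auto simp: dist_norm norm_minus_commute)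
      also have "\<dots> \<le> R" using r2 \<rho> by linarith
      finally show ?thesis by (simp add: dist_norm norm_minus_commute)
    qed
    have cpos: "continuous_on {0..1} (pos w)" and cvel: "continuous_on {0..1} (vel w)"
      and dpos: "s \<in> {0..1} \<Longrightarrow> (pos w has_vector_derivative vel w s) (at s within {0..1})"
      and dvel: "s \<in> {0..1} \<Longrightarrow> (vel w has_vector_derivative w s) (at s within {0..1})"
      for w :: "real \<Rightarrow>\<^sub>C 'a" and s
    proof -
      show dp: "(pos w has_vector_derivative vel w s) (at s within {0..1})" if "s \<in> {0..1}" for s
        unfolding pos_def vel_def using dirichlet_has_derivative[OF cont that]
        by (auto intro!: derivative_eq_intros)
      show dv: "(vel w has_vector_derivative w s) (at s within {0..1})" if "s \<in> {0..1}" for s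
        unfolding vel_def using dirichlet_slope_has_derivative[OF cont that]
        by (auto intro!: derivative_eq_intros)
      show "continuous_on {0..1} (pos w)" "continuous_on {0..1} (vel w)"
        using dp dv by (meson continuous_on_eq_continuous_within has_vector_derivative_continuous)+
    qed
    have cQ: "continuous_on {0..1} (\<lambda>s. Q (pos w s) (vel w s))" if "w \<in> ball_r" for w
      using QL by (rule quadratic_lipschitz_continuous[where D = "cball p R"])
        (use cpos cvel pos_in[OF that] in auto)
    \<comment> \<open>Clamping to the unit interval turns the right-hand side into a bounded continuous function on the
      whole line, so that the complete space of such functions can be used.\<close>
    have "\<exists>g :: real \<Rightarrow>\<^sub>C 'a. \<forall>s. g s = Q (pos w (clamp 0 1 s)) (vel w (clamp 0 1 s))"
      if "w \<in> ball_r" for w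
      using continuous_on_cbox_bcontfunE[of 0 1 "\<lambda>s. Q (pos w s) (vel w s)"] cQ[OF that]
      by (metis box_real(2))
    then obtain \<Phi> :: "(real \<Rightarrow>\<^sub>C 'a) \<Rightarrow> (real \<Rightarrow>\<^sub>C 'a)" where
      \<Phi>: "\<And>w s. w \<in> ball_r \<Longrightarrow> \<Phi> w s = Q (pos w (clamp 0 1 s)) (vel w (clamp 0 1 s))"
      by metis
    have clamp01: "clamp 0 1 s \<in> {0..1}" for s :: real
      using clamp_in_interval[of 0 1 s] by (simp add: cbox_interval)
    have \<Phi>_bound: "norm (\<Phi> w) \<le> 9 * (K * r) * r" if w: "w \<in> ball_r" for w
    proof (rule norm_bound)
      fix s
      have "norm (\<Phi> w s) \<le> K * (norm (vel w (clamp 0 1 s)))\<^sup>2"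
        using Qb[OF pos_in[OF w clamp01]] \<Phi>[OF w] by simp
      also have "\<dots> \<le> K * (3 * r)\<^sup>2"
        using vel_bound[OF w clamp01] K by (intro mult_left_mono power_mono) auto
      finally show "norm (\<Phi> w s) \<le> 9 * (K * r) * r" by (simp add: power2_eq_square algebra_simps)
    qed
    have "9 * (K * r) * r \<le> 1 * r" using Kr2 r0 by (intro mult_right_mono) auto
    then have maps: "\<Phi> ` ball_r \<subseteq> ball_r"
      using \<Phi>_bound by (force simp: ball_r_def)
    have lip: "dist (\<Phi> v) (\<Phi> w) \<le> 1/2 * dist v w" if v: "v \<in> ball_r" and w: "w \<in> ball_r" for v w
    proof -
      have vw: "norm (v s - w s) \<le> norm (v - w)" for s
        using norm_bounded[of "v - w" s] by simp
      have "norm (\<Phi> v - \<Phi> w) \<le> 1/2 * norm (v - w)"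
      proof (rule norm_bound)
        fix s0 :: real
        define s where "s = clamp 0 1 s0"
        have s: "s \<in> {0..1}" using clamp01 by (simp add: s_def)
        have c: "continuous_on {0..1} (\<lambda>s. v s - w s)" by (intro continuous_intros) auto
        have dp: "norm (pos v s - pos w s) \<le> 2 * norm (v - w)"
          using dirichlet_bound[OF c vw s] dirichlet_diff[OF cont cont s, of v w] by (simp add: pos_def)
        have dv: "norm (vel v s - vel w s) \<le> 2 * norm (v - w)"
          using dirichlet_slope_bound[OF c vw s] dirichlet_slope_diff[OF cont cont s, of v w] by (simp add: vel_def)
        have "norm ((\<Phi> v - \<Phi> w) s0) = norm (Q (pos v s) (vel v s) - Q (pos w s) (vel w s))"
          by (simp add: \<Phi> v w s_def)
        also have "\<dots> \<le> K * (norm (pos v s - pos w s) * (norm (vel w s))\<^sup>2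
              + (norm (vel v s) + norm (vel w s)) * norm (vel v s - vel w s))"
          by (intro QL pos_in v w s)
        also have "\<dots> \<le> K * (2 * norm (v - w) * (3 * r)\<^sup>2 + (3 * r + 3 * r) * (2 * norm (v - w)))"
          using vel_bound[OF v s] vel_bound[OF w s] r0
          by (intro mult_left_mono add_mono mult_mono power_mono dp dv K) auto
        also have "\<dots> = (18 * (K * r) * r + 12 * (K * r)) * norm (v - w)"
          by (simp add: power2_eq_square algebra_simps)
        also have "\<dots> \<le> (18 * (1/60) * 1 + 12 * (1/60)) * norm (v - w)"
          using Kr2 r1 r0 K by (intro mult_right_mono add_mono mult_mono) auto
        finally show "norm ((\<Phi> v - \<Phi> w) s0) \<le> 1/2 * norm (v - w)" by simp
      qed
      then show ?thesis by (simp add: dist_norm)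
    qed
    have "\<exists>!w\<in>ball_r. \<Phi> w = w"
    proof (rule Banach_fix[OF _ _ _ _ maps lip])
      show "complete ball_r" by (simp add: ball_r_def complete_eq_closed)
      show "ball_r \<noteq> {}" using r0 by (auto simp: ball_r_def intro!: exI[of _ 0])
    qed auto
    then obtain w where w: "w \<in> ball_r" "\<Phi> w = w" by auto
    have ws: "w s = Q (pos w s) (vel w s)" if "s \<in> {0..1}" for s
    proof -
      have "clamp 0 1 s = s" using that by (intro clamp_cancel_cbox) (simp add: cbox_interval)
      then show ?thesis using \<Phi>[OF w(1), of s] w(2) by simp
    qed
    have vel_nz: "vel w s \<noteq> 0" if s: "s \<in> {0..1}" for s
    proof
      assume "vel w s = 0"
      then have "r = norm (dirichlet_slope w s)"
        by (metis vel_def r_def add_eq_0_iff norm_minus_cancel)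
      also have "\<dots> \<le> 2 * (9 * (K * r) * r)"
        using \<Phi>_bound[OF w(1)] w(2) norm_bounded[of w] by (intro dirichlet_slope_bound cont s) (metis order_trans)
      also have "\<dots> = (18 * (K * r)) * r" by simp
      also have "\<dots> \<le> (18 * (1 / 60)) * r" using Kr2 r0 by (intro mult_right_mono mult_left_mono) auto
      also have "\<dots> < r" using r0 by simp
      finally show False by simp
    qed
    show "\<exists>c c'. c 0 = a \<and> c 1 = b \<and>
      (\<forall>s\<in>{0..1}. c s \<in> cball p R \<and> c' s \<noteq> 0 \<and> norm (c' s) \<le> 3 * norm (b - a) \<and>
         (c has_vector_derivative c' s) (at s within {0..1}) \<and>
         (c' has_vector_derivative Q (c s) (c' s)) (at s within {0..1}))"
    proof (rule exI[of _ "pos w"], rule exI[of _ "vel w"], intro conjI ballI)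
      show "pos w 0 = a" "pos w 1 = b" by (simp_all add: pos_def dirichlet_0 dirichlet_1)
      fix s :: real assume s: "s \<in> {0..1}"
      show "pos w s \<in> cball p R" "vel w s \<noteq> 0" "norm (vel w s) \<le> 3 * norm (b - a)"
        using pos_in[OF w(1) s] vel_nz[OF s] vel_bound[OF w(1) s] by (auto simp: r_def)
      show "(pos w has_vector_derivative vel w s) (at s within {0..1})" by (rule dpos[OF s])
      show "(vel w has_vector_derivative Q (pos w s) (vel w s)) (at s within {0..1})"
        using dvel[OF s, of w] ws[OF s] by simp
    qed
  qed
qed

section \<open>Surfaces as level sets\<close>

lemma smooth_on_directional:
  assumes "smooth_on U f"
  shows "smooth_on U (\<lambda>x. frechet_derivative f (at x) v)"
  using assms by (metis smooth_on_def Ck_on.simps(2))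

lemma smooth_on_has_derivative:
  assumes "smooth_on U f" "x \<in> U"
  shows "(f has_derivative frechet_derivative f (at x)) (at x)"
  using assms by (metis smooth_on_def Ck_on.simps(2) frechet_derivative_works)

lemma smooth_on_continuous_on:
  "smooth_on U f \<Longrightarrow> continuous_on U f"
  by (metis smooth_on_def Ck_on.simps(1))

text \<open>Mean value inequality, with the norm of the derivative controlled by the finitely many partial
  derivatives, each of which is continuous and hence bounded on \<open>C\<close>.\<close>

lemma smooth_on_bounded_lipschitz:
  fixes f :: "'a::euclidean_space \<Rightarrow> 'b::real_normed_vector"
  assumes f: "smooth_on U f" and C: "compact C" "convex C" "C \<subseteq> U"
  shows "\<exists>L\<ge>0. \<forall>x\<in>C. \<forall>y\<in>C. norm (f x) \<le> L \<and> norm (f x - f y) \<le> L * norm (x - y)"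
proof -
  define D where "D x = (\<Sum>b\<in>Basis. norm (frechet_derivative f (at x) b))" for x
  have "bounded ((\<lambda>x. norm (f x) + D x) ` C)"
    unfolding D_def
    by (intro compact_imp_bounded compact_continuous_image C continuous_intros
        continuous_on_subset[OF smooth_on_continuous_on C(3)] f smooth_on_directional)
  then obtain L where L: "L > 0" "\<And>x. x \<in> C \<Longrightarrow> norm (norm (f x) + D x) \<le> L"
    by (auto simp: bounded_pos)
  have D0: "D x \<ge> 0" for x by (auto simp: D_def intro: sum_nonneg)
  have le: "norm (f x) \<le> L" "D x \<le> L" if "x \<in> C" for x
    using L(2)[OF that] D0[of x] norm_ge_zero[of "f x"] unfolding real_norm_def by linarith+
  have on: "onorm (frechet_derivative f (at x)) \<le> L" if x: "x \<in> C" for x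
  proof (rule onorm_bound)
    interpret bounded_linear "frechet_derivative f (at x)"
      using smooth_on_has_derivative[OF f] x C(3) by (auto simp: has_derivative_def)
    fix v
    have "frechet_derivative f (at x) v = (\<Sum>b\<in>Basis. (v \<bullet> b) *\<^sub>R frechet_derivative f (at x) b)"
      by (subst euclidean_representation[of v, symmetric]) (simp only: sum scaleR)
    also have "norm \<dots> \<le> (\<Sum>b\<in>Basis. norm v * norm (frechet_derivative f (at x) b))"
      by (intro sum_norm_le) (auto intro!: mult_right_mono Basis_le_norm)
    also have "\<dots> = norm v * D x" by (simp add: D_def sum_distrib_left)
    also have "\<dots> \<le> norm v * L" by (intro mult_left_mono le x) auto
    finally show "norm (frechet_derivative f (at x) v) \<le> L * norm v" by (simp add: mult.commute)
  qed (use L in auto)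
  have "norm (f x - f y) \<le> L * norm (x - y)" if "x \<in> C" "y \<in> C" for x y
    by (rule differentiable_bound[OF C(2) _ on])
      (use that smooth_on_has_derivative[OF f] C(3) in \<open>auto intro: has_derivative_at_withinI\<close>)
  then show ?thesis using le(1) L(1) by (intro exI[of _ L]) auto
qed

text \<open>All that is used of a surface near one of its points \<open>p\<close>: inside a closed ball, \<open>S\<close> is the zero
  set of a function \<open>F\<close> with gradient field \<open>G\<close>. The derivative \<open>G'\<close> of the gradient (the Hessian of
  \<open>F\<close>) is bounded and Lipschitz, the gradient stays away from zero, and the Gauss map is parallel to
  it. The constants are uniform so that the estimates below depend only on the patch.\<close>

locale level_set_patch =
  fixes S :: "(real^3) set" and n :: "real^3 \<Rightarrow> real^3" and p :: "real^3" and R m K :: real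
    and F :: "real^3 \<Rightarrow> real" and G :: "real^3 \<Rightarrow> real^3" and G' :: "real^3 \<Rightarrow> real^3 \<Rightarrow> real^3"
  assumes R_pos: "0 < R" and m_pos: "0 < m" and K_nonneg: "0 \<le> K"
    and mem_iff: "\<And>x. x \<in> cball p R \<Longrightarrow> x \<in> S \<longleftrightarrow> F x = 0"
    and F_deriv: "\<And>x. x \<in> cball p R \<Longrightarrow> (F has_derivative (\<lambda>v. G x \<bullet> v)) (at x)"
    and G_deriv: "\<And>x. x \<in> cball p R \<Longrightarrow> (G has_derivative G' x) (at x)"
    and G_lower: "\<And>x. x \<in> cball p R \<Longrightarrow> m \<le> norm (G x)"
    and G'_bound: "\<And>x v. x \<in> cball p R \<Longrightarrow> norm (G' x v) \<le> K * norm v"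
    and G'_lipschitz: "\<And>x y v. \<lbrakk>x \<in> cball p R; y \<in> cball p R\<rbrakk> \<Longrightarrow>
          norm (G' x v - G' y v) \<le> K * norm (x - y) * norm v"
    and n_parallel: "\<And>x. \<lbrakk>x \<in> S; x \<in> cball p R\<rbrakk> \<Longrightarrow> norm (n x) = 1 \<and> (\<exists>k. n x = k *\<^sub>R G x)"

text \<open>A vector \<open>v\<close> that the chart \<open>\<phi>\<close> maps into the coordinate plane is the velocity of the
  \<open>\<psi>\<close>-image of a straight line in that plane.\<close>

lemma level_set_gradient_kernel_tangent:
  fixes \<phi> \<psi> :: "real^3 \<Rightarrow> real^3" and S V W :: "(real^3) set" and x v :: "real^3"
  assumes V: "open V" and W: "open W" and hom: "homeomorphism V W \<phi> \<psi>"
    and \<phi>: "smooth_on V \<phi>" and \<psi>: "smooth_on W \<psi>"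
    and img: "\<phi> ` (S \<inter> V) = {y \<in> W. y $ 3 = 0}"
    and x: "x \<in> S" "x \<in> V"
    and v: "frechet_derivative \<phi> (at x) v $ 3 = 0"
  shows "v \<in> tangent_space S x"
proof -
  define u where "u = frechet_derivative \<phi> (at x) v"
  define c where "c s = \<psi> (\<phi> x + s *\<^sub>R u)" for s :: real
  have "\<phi> x \<in> \<phi> ` (S \<inter> V)" using x by (intro imageI IntI)
  then have "\<phi> x \<in> {y \<in> W. y $ 3 = 0}" by (simp only: img)
  then have \<phi>x: "\<phi> x \<in> W" "\<phi> x $ 3 = 0" "\<psi> (\<phi> x) = x"
    using homeomorphism_apply1[OF hom x(2)] by simp_all
  have d\<phi>: "(\<phi> has_derivative frechet_derivative \<phi> (at x)) (at x)"
    by (rule smooth_on_has_derivative[OF \<phi> x(2)])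
  have d\<psi>: "(\<psi> has_derivative frechet_derivative \<psi> (at (\<phi> x))) (at (\<phi> x))"
    by (rule smooth_on_has_derivative[OF \<psi> \<phi>x(1)])
  have "((\<psi> \<circ> \<phi>) has_derivative (frechet_derivative \<psi> (at (\<phi> x)) \<circ> frechet_derivative \<phi> (at x))) (at x)"
    using diff_chain_at[OF d\<phi> d\<psi>] .
  moreover have "((\<psi> \<circ> \<phi>) has_derivative id) (at x)"
  proof (rule has_derivative_transform_within_open[OF has_derivative_id V x(2)])
    show "id y = (\<psi> \<circ> \<phi>) y" if "y \<in> V" for y using homeomorphism_apply1[OF hom that] by simp
  qed
  ultimately have "frechet_derivative \<psi> (at (\<phi> x)) \<circ> frechet_derivative \<phi> (at x) = id"
    by (rule has_derivative_unique)
  then have \<psi>u: "frechet_derivative \<psi> (at (\<phi> x)) u = v"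
    unfolding u_def by (simp add: fun_eq_iff)
  have line: "((\<lambda>s. \<phi> x + s *\<^sub>R u) has_derivative (\<lambda>s. s *\<^sub>R u)) (at (0::real))"
    by (auto intro!: derivative_eq_intros)
  have "(c has_derivative (\<lambda>s. frechet_derivative \<psi> (at (\<phi> x)) (s *\<^sub>R u))) (at 0)"
    unfolding c_def using has_derivative_compose[OF line] d\<psi> by simp
  then have dc: "(c has_vector_derivative v) (at 0)"
    using linear_cmul[OF has_derivative_linear[OF d\<psi>]] \<psi>u by (simp add: has_vector_derivative_def)
  have "open ((\<lambda>s::real. \<phi> x + s *\<^sub>R u) -` W)"
    by (intro open_vimage W continuous_intros)
  then obtain e where e: "e > 0" "ball 0 e \<subseteq> (\<lambda>s::real. \<phi> x + s *\<^sub>R u) -` W"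
    using \<phi>x(1) by (elim openE[where x = 0]) auto
  have "c s \<in> S" if "s \<in> {-e<..<e}" for s
  proof -
    have "s \<in> ball 0 e" using that by (simp add: abs_less_iff)
    then have "\<phi> x + s *\<^sub>R u \<in> W" using e(2) by blast
    then have "\<phi> x + s *\<^sub>R u \<in> {y \<in> W. y $ 3 = 0}"
      using \<phi>x(2) v by (simp add: u_def)
    then obtain z where "z \<in> S" "z \<in> V" "\<phi> x + s *\<^sub>R u = \<phi> z" unfolding img[symmetric] by blast
    then show ?thesis using homeomorphism_apply1[OF hom] by (simp add: c_def)
  qed
  moreover have "c 0 = x" using \<phi>x(3) by (simp add: c_def)
  ultimately have "e > 0 \<and> c ` {-e<..<e} \<subseteq> S \<and> c 0 = x \<and> (c has_vector_derivative v) (at 0)"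
    using e(1) dc by auto
  then show ?thesis unfolding tangent_space_def by blast
qed

text \<open>The component of \<open>m\<close> orthogonal to \<open>g\<close> lies in the kernel and is therefore orthogonal to itself.\<close>

lemma parallel_if_orthogonal_to_kernel:
  fixes g m :: "'a::real_inner"
  assumes "g \<noteq> 0" "\<And>v. g \<bullet> v = 0 \<Longrightarrow> m \<bullet> v = 0"
  shows "\<exists>k. m = k *\<^sub>R g"
proof -
  define k where "k = (g \<bullet> m) / (g \<bullet> g)"
  define v where "v = m - k *\<^sub>R g"
  have gv: "g \<bullet> v = 0" using assms(1) by (simp add: v_def k_def inner_diff_right)
  then have "v \<bullet> v = 0"
    using assms(2)[OF gv] by (simp add: v_def inner_diff_left inner_diff_right inner_commute)
  then show ?thesis by (auto simp: v_def)
qed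

text \<open>The defining function is the third component of a chart. Its gradient does not vanish because the
  derivative of the chart is onto. The kernel of the gradient consists of tangent vectors, to which
  the Gauss map is orthogonal, so the Gauss map is a multiple of the gradient.\<close>

lemma surface_level_set_patch:
  assumes S: "smooth_surface S" and n: "gauss_map S n" and p: "p \<in> S"
  obtains R m K F G G' where "level_set_patch S n p R m K F G G'"
proof -
  from bspec[OF S[unfolded smooth_surface_def] p]
  obtain V W and \<phi> \<psi> :: "real^3 \<Rightarrow> real^3" where V: "open V" "p \<in> V" and W: "open W"
    and hom: "homeomorphism V W \<phi> \<psi>" and \<phi>: "smooth_on V \<phi>" and \<psi>: "smooth_on W \<psi>"
    and img: "\<phi> ` (S \<inter> V) = {y \<in> W. y $ 3 = 0}"
    by (elim exE conjE) (rule that; assumption)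
  obtain R where R: "0 < R" "cball p R \<subseteq> V"
    using V open_contains_cball by blast
  define D where "D b x = frechet_derivative \<phi> (at x) b" for b x
  have D: "smooth_on V (D b)" for b
    unfolding D_def by (rule smooth_on_directional[OF \<phi>])
  define D2 where "D2 b b' x = frechet_derivative (D b) (at x) b'" for b b' x
  have D2: "smooth_on V (D2 b b')" for b b'
    unfolding D2_def by (rule smooth_on_directional[OF D])
  define F where "F x = \<phi> x $ 3" for x
  \<comment> \<open>Written with respect to a basis, the gradient inherits differentiability from the directional
      derivatives of the chart.\<close>
  define G where "G x = (\<Sum>b\<in>Basis. (D b x $ 3) *\<^sub>R b)" for x :: "real^3"
  define G' where "G' x v = (\<Sum>b\<in>Basis. (frechet_derivative (D b) (at x) v $ 3) *\<^sub>R b)" for x v :: "real^3"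
  have lin_\<phi>: "bounded_linear (frechet_derivative \<phi> (at x))" if "x \<in> V" for x
    using smooth_on_has_derivative[OF \<phi> that] by (simp add: has_derivative_def)
  have Gv: "G x \<bullet> v = frechet_derivative \<phi> (at x) v $ 3" if "x \<in> V" for x v
  proof -
    interpret bounded_linear "frechet_derivative \<phi> (at x)" by (rule lin_\<phi>[OF that])
    have "frechet_derivative \<phi> (at x) v = (\<Sum>b\<in>Basis. (v \<bullet> b) *\<^sub>R D b x)"
      unfolding D_def by (subst euclidean_representation[of v, symmetric]) (simp only: sum scaleR)
    then have "frechet_derivative \<phi> (at x) v $ 3 = (\<Sum>b\<in>Basis. (v \<bullet> b) * D b x $ 3)" by simp
    also have "\<dots> = G x \<bullet> v"
      unfolding G_def inner_sum_left inner_scaleR_left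
      by (rule sum.cong) (simp_all only: inner_commute mult.commute)
    finally show ?thesis by simp
  qed
  have comp: "bounded_linear (\<lambda>x :: real^3. x $ 3)" by (rule bounded_linear_vec_nth)
  have dF: "(F has_derivative (\<lambda>v. G x \<bullet> v)) (at x)" if "x \<in> V" for x
    unfolding F_def Gv[OF that]
    by (rule bounded_linear.has_derivative[OF comp smooth_on_has_derivative[OF \<phi> that]])
  have dG: "(G has_derivative G' x) (at x)" if "x \<in> V" for x
    unfolding G_def G'_def
    by (rule has_derivative_sum, rule has_derivative_scaleR_left,
        rule bounded_linear.has_derivative[OF comp], rule smooth_on_has_derivative[OF D that])
  have G_nz: "G x \<noteq> 0" if x: "x \<in> V" for x
  proof
    assume "G x = 0"
    have \<phi>x: "\<phi> x \<in> W" "\<psi> (\<phi> x) = x"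
      using homeomorphism_image1[OF hom] homeomorphism_apply1[OF hom] x by auto
    have d\<psi>: "(\<psi> has_derivative frechet_derivative \<psi> (at (\<phi> x))) (at (\<phi> x))"
      by (rule smooth_on_has_derivative[OF \<psi> \<phi>x(1)])
    have "((\<phi> \<circ> \<psi>) has_derivative (frechet_derivative \<phi> (at x) \<circ> frechet_derivative \<psi> (at (\<phi> x)))) (at (\<phi> x))"
      using diff_chain_at[OF d\<psi>, unfolded \<phi>x(2), OF smooth_on_has_derivative[OF \<phi> x]] .
    moreover have "((\<phi> \<circ> \<psi>) has_derivative id) (at (\<phi> x))"
    proof (rule has_derivative_transform_within_open[OF has_derivative_id W \<phi>x(1)])
      show "id y = (\<phi> \<circ> \<psi>) y" if "y \<in> W" for y using homeomorphism_apply2[OF hom that] by simp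
    qed
    ultimately have "frechet_derivative \<phi> (at x) \<circ> frechet_derivative \<psi> (at (\<phi> x)) = id"
      by (rule has_derivative_unique)
    from fun_cong[OF this, of "axis 3 1"]
    have "G x \<bullet> frechet_derivative \<psi> (at (\<phi> x)) (axis 3 1) = 1"
      unfolding Gv[OF x] by simp
    then show False using \<open>G x = 0\<close> by simp
  qed
  have cG: "continuous_on V G"
    unfolding G_def by (intro continuous_intros smooth_on_continuous_on[OF D])
  have "continuous_on (cball p R) (\<lambda>x. norm (G x))"
    using cG R(2) by (auto intro!: continuous_intros intro: continuous_on_subset)
  then obtain x0 where x0: "x0 \<in> cball p R" "\<And>x. x \<in> cball p R \<Longrightarrow> norm (G x0) \<le> norm (G x)"
    using continuous_attains_inf[OF compact_cball, of p R "\<lambda>x. norm (G x)"] R(1) by auto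
  define L where "L b b' = (SOME L. L \<ge> 0 \<and> (\<forall>x\<in>cball p R. \<forall>y\<in>cball p R.
      norm (D2 b b' x) \<le> L \<and> norm (D2 b b' x - D2 b b' y) \<le> L * norm (x - y)))" for b b'
  have L: "L b b' \<ge> 0 \<and> (\<forall>x\<in>cball p R. \<forall>y\<in>cball p R.
      norm (D2 b b' x) \<le> L b b' \<and> norm (D2 b b' x - D2 b b' y) \<le> L b b' * norm (x - y))" for b b'
    unfolding L_def
    by (rule someI_ex, rule smooth_on_bounded_lipschitz[OF D2 compact_cball convex_cball R(2)])
  define K where "K = (\<Sum>b\<in>(Basis::(real^3) set). \<Sum>b'\<in>(Basis::(real^3) set). L b b')"
  have G'_rep: "G' x v = (\<Sum>b\<in>Basis. (\<Sum>b'\<in>Basis. (v \<bullet> b') * D2 b b' x $ 3) *\<^sub>R b)" if "x \<in> V" for x v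
  proof -
    have "frechet_derivative (D b) (at x) v = (\<Sum>b'\<in>Basis. (v \<bullet> b') *\<^sub>R D2 b b' x)" for b
    proof -
      interpret bounded_linear "frechet_derivative (D b) (at x)"
        using smooth_on_has_derivative[OF D that] by (simp add: has_derivative_def)
      show ?thesis
        unfolding D2_def by (subst euclidean_representation[of v, symmetric]) (simp only: sum scaleR)
    qed
    then show ?thesis by (simp add: G'_def)
  qed
  have sum_bound: "norm (\<Sum>b\<in>(Basis::(real^3) set). (\<Sum>b'\<in>Basis. (v \<bullet> b') * z b b' $ 3) *\<^sub>R b) \<le> K * B * norm v"
    if z: "\<And>b b'. norm (z b b' :: real^3) \<le> L b b' * B" for v :: "real^3" and z B
  proof -
    have "norm (\<Sum>b\<in>(Basis::(real^3) set). (\<Sum>b'\<in>Basis. (v \<bullet> b') * z b b' $ 3) *\<^sub>R b)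
       \<le> (\<Sum>b\<in>(Basis::(real^3) set). \<Sum>b'\<in>(Basis::(real^3) set). norm v * (L b b' * B))"
    proof (rule sum_norm_le)
      fix b :: "real^3" assume "b \<in> Basis"
      then have "norm ((\<Sum>b'\<in>Basis. (v \<bullet> b') * z b b' $ 3) *\<^sub>R b) = \<bar>\<Sum>b'\<in>Basis. (v \<bullet> b') * z b b' $ 3\<bar>"
        by simp
      also have "\<dots> \<le> (\<Sum>b'\<in>Basis. \<bar>(v \<bullet> b') * z b b' $ 3\<bar>)" by (rule sum_abs)
      also have "\<dots> \<le> (\<Sum>b'\<in>Basis. norm v * (L b b' * B))"
        unfolding abs_mult
        by (intro sum_mono mult_mono Basis_le_norm order_trans[OF component_le_norm_cart z]) auto
      finally show "norm ((\<Sum>b'\<in>Basis. (v \<bullet> b') * z b b' $ 3) *\<^sub>R b) \<le> (\<Sum>b'\<in>Basis. norm v * (L b b' * B))" .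
    qed
    also have "\<dots> = K * B * norm v"
      by (simp add: K_def sum_distrib_left sum_distrib_right mult_ac)
    finally show ?thesis .
  qed
  have n_par: "norm (n x) = 1 \<and> (\<exists>k. n x = k *\<^sub>R G x)" if x: "x \<in> S" "x \<in> cball p R" for x
  proof
    have xV: "x \<in> V" using x(2) R(2) by blast
    have nx: "norm (n x) = 1" "\<And>v. v \<in> tangent_space S x \<Longrightarrow> n x \<bullet> v = 0"
      using bspec[OF conjunct2[OF n[unfolded gauss_map_def]] x(1)] by blast+
    show "norm (n x) = 1" by (rule nx)
    show "\<exists>k. n x = k *\<^sub>R G x"
    proof (rule parallel_if_orthogonal_to_kernel[OF G_nz[OF xV]])
      fix v assume "G x \<bullet> v = 0"
      then have "frechet_derivative \<phi> (at x) v $ 3 = 0" by (simp only: Gv[OF xV])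
      then show "n x \<bullet> v = 0"
        by (intro nx(2) level_set_gradient_kernel_tangent[OF V(1) W hom \<phi> \<psi> img x(1) xV])
    qed
  qed
  have "level_set_patch S n p R (norm (G x0)) K F G G'"
  proof (rule level_set_patch.intro)
    show "0 < R" by fact
    show "0 < norm (G x0)" using G_nz[OF subsetD[OF R(2) x0(1)]] by simp
    show "0 \<le> K" unfolding K_def by (intro sum_nonneg conjunct1[OF L])
    fix x assume x: "x \<in> cball p R"
    have xV: "x \<in> V" using x R(2) by blast
    show "x \<in> S \<longleftrightarrow> F x = 0"
    proof
      assume "x \<in> S"
      then have "\<phi> x \<in> \<phi> ` (S \<inter> V)" using xV by (intro imageI IntI)
      then show "F x = 0" unfolding img F_def by simp
    next
      assume "F x = 0"
      moreover have "\<phi> x \<in> W" using imageI[OF xV, of \<phi>] homeomorphism_image1[OF hom] by simp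
      ultimately have "\<phi> x \<in> \<phi> ` (S \<inter> V)" unfolding img F_def by simp
      then obtain z where z: "\<phi> x = \<phi> z" "z \<in> S \<inter> V" by (rule imageE)
      have "\<psi> (\<phi> x) = x" "\<psi> (\<phi> z) = z"
        by (rule homeomorphism_apply1[OF hom xV], rule homeomorphism_apply1[OF hom IntD2[OF z(2)]])
      then have "x = z" unfolding z(1) by (simp only:)
      then show "x \<in> S" using z(2) by simp
    qed
    show "(F has_derivative (\<lambda>v. G x \<bullet> v)) (at x)" "(G has_derivative G' x) (at x)"
      by (rule dF[OF xV], rule dG[OF xV])
    show "norm (G x0) \<le> norm (G x)" by (rule x0(2)[OF x])
    have "norm (D2 b b' x) \<le> L b b' * 1" for b b' using L x by simp
    from sum_bound[OF this] show "norm (G' x v) \<le> K * norm v" for v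
      unfolding G'_rep[OF xV] by simp
    fix y v assume y: "y \<in> cball p R"
    then have yV: "y \<in> V" using R(2) by blast
    have "G' x v - G' y v = (\<Sum>b\<in>Basis. (\<Sum>b'\<in>Basis. (v \<bullet> b') * (D2 b b' x - D2 b b' y) $ 3) *\<^sub>R b)"
      unfolding G'_rep[OF xV] G'_rep[OF yV]
      by (simp add: sum_subtractf scaleR_left_diff_distrib right_diff_distrib)
    moreover have "norm (D2 b b' x - D2 b b' y) \<le> L b b' * norm (x - y)" for b b'
      using L x y by blast
    ultimately show "norm (G' x v - G' y v) \<le> K * norm (x - y) * norm v"
      using sum_bound[of "\<lambda>b b'. D2 b b' x - D2 b b' y" "norm (x - y)" v] by presburger
    show "norm (n x) = 1 \<and> (\<exists>k. n x = k *\<^sub>R G x)" if "x \<in> S" by (rule n_par[OF that x])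
  qed
  then show ?thesis by (rule that)
qed

section \<open>Existence of short geodesics\<close>

lemma velocity_eqI:
  assumes "(c has_vector_derivative v) (at u within A)" "at u within A \<noteq> bot"
  shows "velocity A c u = v"
  unfolding velocity_def using assms by (rule vector_derivative_within[rotated])

lemma at_within_unit_interval: "u \<in> {0..1::real} \<Longrightarrow> at u within {0..1} \<noteq> bot"
  by (simp add: trivial_limit_within islimpt_Icc)

lemma regular_C2_curveD:
  assumes "regular_C2_curve A c" "u \<in> A"
  shows "(c has_vector_derivative velocity A c u) (at u within A)"
    and "(velocity A c has_vector_derivative velocity A (velocity A c) u) (at u within A)"
    and "velocity A c u \<noteq> 0"
  using assms vector_derivative_works unfolding regular_C2_curve_def velocity_def by blast+

lemma regular_C2_curve_velocity_continuous:
  assumes "regular_C2_curve A c"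
  shows "continuous_on A (velocity A c)"
  using regular_C2_curveD(2)[OF assms]
  by (meson continuous_on_eq_continuous_within has_vector_derivative_continuous)

text \<open>The well-known distortion formula of the inversion in the unit sphere. It makes the Lipschitz
  constant of \<open>G / |G|\<^sup>2\<close> explicit.\<close>

lemma inversion_dist:
  fixes a b :: "'a::real_inner"
  assumes "a \<noteq> 0" "b \<noteq> 0"
  shows "norm (a /\<^sub>R (a \<bullet> a) - b /\<^sub>R (b \<bullet> b)) = norm (a - b) / (norm a * norm b)"
proof -
  have nz: "a \<bullet> a \<noteq> 0" "b \<bullet> b \<noteq> 0" using assms by auto
  have "(norm (a /\<^sub>R (a \<bullet> a) - b /\<^sub>R (b \<bullet> b)))\<^sup>2 = (norm (a - b) / (norm a * norm b))\<^sup>2"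
    using nz unfolding power_divide power_mult_distrib power2_norm_eq_inner
    by (simp add: inner_diff_left inner_diff_right inner_commute[of b a] field_simps)
  then show ?thesis by (subst (asm) power2_eq_iff_nonneg) auto
qed

context level_set_patch
begin

text \<open>The multiple of the gradient for which a curve with \<open>c'' = normal_acceleration c c'\<close> satisfies
  \<open>(F \<circ> c)'' = 0\<close>. This extends the geodesic equation from \<open>S\<close> to a full neighbourhood in space, so
  that no coordinates on the surface are needed.\<close>

definition normal_acceleration :: "real^3 \<Rightarrow> real^3 \<Rightarrow> real^3" where
  "normal_acceleration x v = - (G' x v \<bullet> v) *\<^sub>R (G x /\<^sub>R (G x \<bullet> G x))"

lemma G_nonzero: "x \<in> cball p R \<Longrightarrow> G x \<noteq> 0"
  using G_lower m_pos by force

lemma G'_linear: "x \<in> cball p R \<Longrightarrow> bounded_linear (G' x)"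
  using G_deriv by (rule has_derivative_bounded_linear)

lemma G_lipschitz:
  assumes "x \<in> cball p R" "y \<in> cball p R"
  shows "norm (G x - G y) \<le> K * norm (x - y)"
proof (rule differentiable_bound[OF convex_cball])
  show "(G has_derivative G' z) (at z within cball p R)" if "z \<in> cball p R" for z
    using G_deriv[OF that] by (rule has_derivative_at_withinI)
  show "onorm (G' z) \<le> K" if "z \<in> cball p R" for z
    using K_nonneg G'_bound[OF that] by (rule onorm_bound)
qed fact+

lemma unit_normal_parallel:
  assumes "x \<in> S" "x \<in> cball p R"
  shows "norm (n x) = 1" "G x = (G x \<bullet> n x) *\<^sub>R n x" "\<bar>G x \<bullet> n x\<bar> = norm (G x)"
proof -
  obtain k where k: "n x = k *\<^sub>R G x" and n1: "norm (n x) = 1" using n_parallel[OF assms] by blast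
  have "n x \<bullet> n x = 1" using n1 by (simp add: norm_eq_1)
  then have kk: "k * k * (G x \<bullet> G x) = 1" by (simp add: k algebra_simps)
  show G: "G x = (G x \<bullet> n x) *\<^sub>R n x" using kk by (simp add: k mult_ac)
  show "norm (n x) = 1" by (rule n1)
  have "norm (G x) = norm ((G x \<bullet> n x) *\<^sub>R n x)" using G by (rule arg_cong)
  then show "\<bar>G x \<bullet> n x\<bar> = norm (G x)" using n1 by simp
qed

lemma second_form_bound:
  assumes "x \<in> cball p R"
  shows "\<bar>G' x v \<bullet> v\<bar> \<le> K * (norm v)\<^sup>2"
proof -
  have "\<bar>G' x v \<bullet> v\<bar> \<le> norm (G' x v) * norm v" by (rule Cauchy_Schwarz_ineq2)
  also have "\<dots> \<le> K * norm v * norm v" by (intro mult_right_mono G'_bound assms) auto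
  finally show ?thesis by (simp add: power2_eq_square mult.assoc)
qed

lemma second_form_lipschitz:
  assumes x: "x \<in> cball p R" and y: "y \<in> cball p R"
  shows "\<bar>G' x v \<bullet> v - G' y w \<bullet> w\<bar> \<le> K * (norm (x - y) * (norm w)\<^sup>2 + (norm v + norm w) * norm (v - w))"
proof -
  interpret bounded_linear "G' x" by (rule G'_linear[OF x])
  have "G' x v \<bullet> v - G' y w \<bullet> w = G' x v \<bullet> (v - w) + G' x (v - w) \<bullet> w + (G' x w - G' y w) \<bullet> w"
    by (simp add: diff inner_diff_left inner_diff_right)
  also have "\<bar>\<dots>\<bar> \<le> norm (G' x v) * norm (v - w) + norm (G' x (v - w)) * norm w + norm (G' x w - G' y w) * norm w"
    using Cauchy_Schwarz_ineq2[of "G' x v" "v - w"] Cauchy_Schwarz_ineq2[of "G' x (v - w)" w]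
      Cauchy_Schwarz_ineq2[of "G' x w - G' y w" w] by linarith
  also have "\<dots> \<le> (K * norm v) * norm (v - w) + (K * norm (v - w)) * norm w + (K * norm (x - y) * norm w) * norm w"
    by (intro add_mono mult_right_mono G'_bound G'_lipschitz x y) auto
  finally show ?thesis by (simp add: power2_eq_square algebra_simps)
qed

lemma inverse_gradient_bound:
  assumes "x \<in> cball p R"
  shows "norm (G x /\<^sub>R (G x \<bullet> G x)) \<le> 1 / m"
proof -
  have "norm (G x /\<^sub>R (G x \<bullet> G x)) = 1 / norm (G x)"
    using G_nonzero[OF assms] by (simp add: power2_norm_eq_inner[symmetric] power2_eq_square field_simps)
  also have "\<dots> \<le> 1 / m" using G_lower[OF assms] m_pos by (intro divide_left_mono mult_pos_pos) auto
  finally show ?thesis .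
qed

lemma inverse_gradient_lipschitz:
  assumes x: "x \<in> cball p R" and y: "y \<in> cball p R"
  shows "norm (G x /\<^sub>R (G x \<bullet> G x) - G y /\<^sub>R (G y \<bullet> G y)) \<le> K * norm (x - y) / (m * m)"
  unfolding inversion_dist[OF G_nonzero[OF x] G_nonzero[OF y]]
  using G_lower[OF x] G_lower[OF y] m_pos K_nonneg
  by (intro frac_le mult_mono G_lipschitz x y) auto

lemma normal_acceleration_bound:
  assumes "x \<in> cball p R"
  shows "norm (normal_acceleration x v) \<le> K / m * (norm v)\<^sup>2"
proof -
  have "norm (normal_acceleration x v) = \<bar>G' x v \<bullet> v\<bar> * norm (G x /\<^sub>R (G x \<bullet> G x))"
    by (simp only: normal_acceleration_def norm_scaleR abs_minus_cancel)
  also have "\<dots> \<le> (K * (norm v)\<^sup>2) * (1 / m)"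
    using K_nonneg m_pos
    by (intro mult_mono second_form_bound inverse_gradient_bound assms) auto
  finally show ?thesis by simp
qed

lemma normal_acceleration_lipschitz:
  assumes x: "x \<in> cball p R" and y: "y \<in> cball p R"
  shows "norm (normal_acceleration x v - normal_acceleration y w)
     \<le> (K / m + K * K / (m * m)) * (norm (x - y) * (norm w)\<^sup>2 + (norm v + norm w) * norm (v - w))"
proof -
  define N where "N z = G z /\<^sub>R (G z \<bullet> G z)" for z
  define e where "e = norm (x - y) * (norm w)\<^sup>2 + (norm v + norm w) * norm (v - w)"
  have e: "norm (x - y) * (norm w)\<^sup>2 \<le> e" by (simp add: e_def)
  have "normal_acceleration x v - normal_acceleration y w =
      - (G' x v \<bullet> v - G' y w \<bullet> w) *\<^sub>R N x - (G' y w \<bullet> w) *\<^sub>R (N x - N y)"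
    by (simp add: normal_acceleration_def N_def[symmetric] algebra_simps)
  also have "norm \<dots> \<le> \<bar>G' x v \<bullet> v - G' y w \<bullet> w\<bar> * norm (N x) + \<bar>G' y w \<bullet> w\<bar> * norm (N x - N y)"
    by (rule norm_triangle_le_diff) (simp only: norm_scaleR abs_minus_cancel order_refl)
  also have "\<dots> \<le> (K * e) * (1 / m) + (K * (norm w)\<^sup>2) * (K * norm (x - y) / (m * m))"
    unfolding N_def e_def using K_nonneg m_pos
    by (intro add_mono mult_mono second_form_bound second_form_lipschitz inverse_gradient_bound
        inverse_gradient_lipschitz x y) auto
  also have "\<dots> = K / m * e + K * K / (m * m) * (norm (x - y) * (norm w)\<^sup>2)" by simp
  also have "\<dots> \<le> K / m * e + K * K / (m * m) * e"
    using K_nonneg m_pos by (intro add_left_mono mult_left_mono e) auto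
  finally show ?thesis by (simp add: e_def algebra_simps)
qed

lemma gradient_inner_normal_acceleration:
  "x \<in> cball p R \<Longrightarrow> G x \<bullet> normal_acceleration x v = - (G' x v \<bullet> v)"
  using G_nonzero by (simp add: normal_acceleration_def)

lemma F_along_curve:
  assumes "(c has_vector_derivative v) (at s within A)" "c s \<in> cball p R"
  shows "((\<lambda>s. F (c s)) has_real_derivative G (c s) \<bullet> v) (at s within A)"
  unfolding has_field_derivative_def
  by (rule has_derivative_eq_rhs[OF has_derivative_compose[OF assms(1)[unfolded has_vector_derivative_def]
        F_deriv[OF assms(2)]]]) auto

lemma gradient_along_curve:
  assumes "(c has_vector_derivative v) (at s within A)" "(c' has_vector_derivative w) (at s within A)"
    and "c s \<in> cball p R" "c' s = v"
  shows "((\<lambda>s. G (c s) \<bullet> c' s) has_real_derivative G' (c s) v \<bullet> v + G (c s) \<bullet> w) (at s within A)"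
proof -
  interpret bounded_linear "G' (c s)" by (rule G'_linear[OF assms(3)])
  have "((\<lambda>s. G (c s)) has_derivative (\<lambda>h. h *\<^sub>R G' (c s) v)) (at s within A)"
    using has_derivative_compose[OF assms(1)[unfolded has_vector_derivative_def] G_deriv[OF assms(3)]]
    by (simp add: scaleR)
  from has_derivative_inner[OF this assms(2)[unfolded has_vector_derivative_def]]
  show ?thesis unfolding has_field_derivative_def
    by (rule has_derivative_eq_rhs) (auto simp: assms(4) algebra_simps)
qed

text \<open>Along the curve \<open>F\<close> is an affine function of the parameter, since its second derivative vanishes;
  being zero at both ends, it is zero throughout. This is why the boundary value
  problem can be solved in the ambient space.\<close>

lemma solution_stays_on_surface:
  assumes c: "\<And>s. s \<in> {0..1} \<Longrightarrow> (c has_vector_derivative c' s) (at s within {0..1})"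
    and c': "\<And>s. s \<in> {0..1} \<Longrightarrow> (c' has_vector_derivative normal_acceleration (c s) (c' s)) (at s within {0..1})"
    and in_ball: "\<And>s. s \<in> {0..1} \<Longrightarrow> c s \<in> cball p R"
    and ends: "c 0 \<in> S" "c 1 \<in> S" and s: "s \<in> {0..1::real}"
  shows "c s \<in> S"
proof -
  define g where "g s = G (c s) \<bullet> c' s" for s
  have dF: "((\<lambda>s. F (c s)) has_vector_derivative g s) (at s within {0..1})" if "s \<in> {0..1}" for s
    unfolding g_def has_real_derivative_iff_has_vector_derivative[symmetric]
    using F_along_curve[OF c in_ball] that by blast
  have dg: "(g has_vector_derivative 0) (at s within {0..1})" if "s \<in> {0..1}" for s
    unfolding g_def has_real_derivative_iff_has_vector_derivative[symmetric]
    using gradient_along_curve[OF c[OF that] c'[OF that] in_ball[OF that]]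
      gradient_inner_normal_acceleration[OF in_ball[OF that]] by simp
  have g: "g s = g 0" if "s \<in> {0..1}" for s
    using increment_bound_vector_derivative[OF dg, of 0 0 s] that by auto
  have "((\<lambda>s. F (c s) - s * g 0) has_vector_derivative 0) (at s within {0..1})" if "s \<in> {0..1}" for s
    using dF[OF that] g[OF that] by (auto intro!: derivative_eq_intros)
  from increment_bound_vector_derivative[OF this, of 0 0]
  have *: "F (c s) - s * g 0 = F (c 0)" if "s \<in> {0..1}" for s
    using that by fastforce
  have "F (c 0) = 0" "F (c 1) = 0" using ends mem_iff in_ball by auto
  then have "F (c s) = 0" using *[OF s] *[of 1] by simp
  then show ?thesis using mem_iff in_ball s by blast
qed

text \<open>The solutions of the boundary value problem for the normal acceleration lie on \<open>S\<close>, and they are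
  geodesics because their acceleration is parallel to the gradient, hence to the Gauss map.\<close>

lemma short_geodesics_exist:
  "\<exists>\<rho>>0. \<forall>a\<in>S \<inter> ball p \<rho>. \<forall>b\<in>S \<inter> ball p \<rho>. a \<noteq> b \<longrightarrow>
     (\<exists>c. geodesic_arc S n c \<and> c 0 = a \<and> c 1 = b \<and> arc_len c \<le> 3 * norm (b - a))"
proof -
  define L where "L = K / m + K * K / (m * m)"
  have L0: "0 \<le> L" and KL: "K / m \<le> L" using K_nonneg m_pos by (auto simp: L_def)
  have Qb: "norm (normal_acceleration x v) \<le> L * (norm v)\<^sup>2" if "x \<in> cball p R" for x v
    using normal_acceleration_bound[OF that, of v] mult_right_mono[OF KL, of "(norm v)\<^sup>2"] by simp
  note lip = normal_acceleration_lipschitz[folded L_def]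
  obtain \<rho> where \<rho>: "\<rho> > 0" and sol: "\<forall>a\<in>ball p \<rho>. \<forall>b\<in>ball p \<rho>. a \<noteq> b \<longrightarrow> (\<exists>c c'. c 0 = a \<and> c 1 = b \<and>
    (\<forall>s\<in>{0..1}. c s \<in> cball p R \<and> c' s \<noteq> 0 \<and> norm (c' s) \<le> 3 * norm (b - a) \<and>
       (c has_vector_derivative c' s) (at s within {0..1}) \<and>
       (c' has_vector_derivative normal_acceleration (c s) (c' s)) (at s within {0..1})))"
    using R_pos L0 Qb lip by (rule quadratic_boundary_value_problem)
  have "\<exists>c. geodesic_arc S n c \<and> c 0 = a \<and> c 1 = b \<and> arc_len c \<le> 3 * norm (b - a)"
    if a: "a \<in> S \<inter> ball p \<rho>" and b: "b \<in> S \<inter> ball p \<rho>" and ab: "a \<noteq> b" for a b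
  proof -
    obtain c c' where ends: "c 0 = a" "c 1 = b" and sol': "\<forall>s\<in>{0..1}. c s \<in> cball p R \<and> c' s \<noteq> 0 \<and>
       norm (c' s) \<le> 3 * norm (b - a) \<and> (c has_vector_derivative c' s) (at s within {0..1}) \<and>
       (c' has_vector_derivative normal_acceleration (c s) (c' s)) (at s within {0..1})"
      using sol[rule_format, OF IntD2[OF a] IntD2[OF b] ab] by (elim exE conjE) (rule that)
    note cc = bspec[OF sol']
    have vel: "velocity {0..1} c s = c' s" if "s \<in> {0..1}" for s
      using cc[OF that] at_within_unit_interval[OF that] by (intro velocity_eqI) auto
    have d2: "(velocity {0..1} c has_vector_derivative normal_acceleration (c s) (c' s)) (at s within {0..1})"
      if "s \<in> {0..1}" for s
    proof (unfold has_vector_derivative_def, rule has_derivative_transform[OF that])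
      show "velocity {0..1} c u = c' u" if "u \<in> {0..1}" for u by (rule vel[OF that])
      show "(c' has_derivative (\<lambda>h. h *\<^sub>R normal_acceleration (c s) (c' s))) (at s within {0..1})"
        using cc[OF that] unfolding has_vector_derivative_def by blast
    qed
    have vel2: "velocity {0..1} (velocity {0..1} c) s = normal_acceleration (c s) (c' s)" if "s \<in> {0..1}" for s
      using d2[OF that] at_within_unit_interval[OF that] by (rule velocity_eqI)
    have on_S: "c s \<in> S" if "s \<in> {0..1}" for s
      using solution_stays_on_surface[of c c'] cc ends a b that by auto
    have cont: "continuous_on {0..1} c" "continuous_on {0..1} c'"
      using cc by (meson continuous_on_eq_continuous_within has_vector_derivative_continuous)+
    have "continuous_on {0..1} (\<lambda>s. normal_acceleration (c s) (c' s))"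
      using normal_acceleration_lipschitz cont
      by (rule quadratic_lipschitz_continuous[where D = "cball p R"]) (use cc in auto)
    then have c2: "continuous_on {0..1} (velocity {0..1} (velocity {0..1} c))"
      by (rule continuous_on_eq) (simp add: vel2)
    have "regular_C2_curve {0..1} c"
      unfolding regular_C2_curve_def
    proof (intro conjI ballI c2)
      fix s :: real assume s: "s \<in> {0..1}"
      show "c differentiable at s within {0..1}" using cc[OF s] by (blast intro: differentiableI_vector)
      show "velocity {0..1} c differentiable at s within {0..1}" using d2[OF s] by (blast intro: differentiableI_vector)
      show "velocity {0..1} c s \<noteq> 0" using cc[OF s] vel[OF s] by simp
    qed
    moreover have "covariant_derivative n {0..1} c (velocity {0..1} c) s = 0" if s: "s \<in> {0..1}" for s
    proof -
      define x where "x = c s"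
      have x: "x \<in> S" "x \<in> cball p R" using on_S[OF s] cc[OF s] by (auto simp: x_def)
      define k where "k = - (G' x (c' s) \<bullet> c' s) / (G x \<bullet> G x)"
      have "normal_acceleration x (c' s) = k *\<^sub>R G x" by (simp add: normal_acceleration_def k_def divide_inverse)
      also have "\<dots> = (k * (G x \<bullet> n x)) *\<^sub>R n x" using unit_normal_parallel(2)[OF x] by (metis scaleR_scaleR)
      finally have "normal_acceleration x (c' s) = (k * (G x \<bullet> n x)) *\<^sub>R n x" .
      moreover have "n x \<bullet> n x = 1" using unit_normal_parallel(1)[OF x] by (simp add: norm_eq_1)
      ultimately show ?thesis by (simp add: covariant_derivative_def vel2[OF s] x_def[symmetric])
    qed
    ultimately have geo: "geodesic_arc S n c" using on_S by (auto simp: geodesic_arc_def)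
    have "arc_len c = integral {0..1} (\<lambda>s. norm (c' s))"
      unfolding arc_len_def by (rule Henstock_Kurzweil_Integration.integral_cong) (simp add: vel)
    also have "\<dots> \<le> integral {0..1::real} (\<lambda>s. 3 * norm (b - a))"
      by (intro integral_le integrable_continuous_real continuous_intros cont) (use cc in auto)
    finally have "arc_len c \<le> 3 * norm (b - a)" by simp
    then show ?thesis using geo ends by blast
  qed
  then show ?thesis using \<rho> by blast
qed

end

section \<open>Second-order behaviour of short geodesics\<close>

definition tangential :: "real^3 \<Rightarrow> real^3 \<Rightarrow> real^3" where
  "tangential m v = v - (v \<bullet> m) *\<^sub>R m"

lemma tangential_linear: "bounded_linear (tangential m)"
  unfolding linear_conv_bounded_linear[symmetric]
  by (rule linearI) (simp_all add: tangential_def inner_add_left algebra_simps)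

lemma tangential_self: "norm m = 1 \<Longrightarrow> tangential m m = 0"
  by (simp add: tangential_def norm_eq_1)

lemma tangential_orthogonal: "m \<bullet> v = 0 \<Longrightarrow> tangential m v = v"
  by (simp add: tangential_def inner_commute)

lemma norm_tangential_le:
  assumes "norm m = 1"
  shows "norm (tangential m v) \<le> norm v"
proof -
  have "m \<bullet> m = 1" using assms by (simp add: norm_eq_1)
  then have "tangential m v \<bullet> tangential m v = v \<bullet> v - (v \<bullet> m) * (v \<bullet> m)"
    by (simp add: tangential_def inner_diff_left inner_diff_right inner_commute[of m v])
  then have "tangential m v \<bullet> tangential m v \<le> v \<bullet> v" by simp
  then show ?thesis by (simp add: norm_le)
qed

lemma chord_le_arc_len:
  assumes c: "regular_C2_curve {0..1} c" and s: "s \<in> {0..1}" and u: "u \<in> {0..1}"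
  shows "norm (c s - c u) \<le> arc_len c"
proof -
  define v where "v = velocity {0..1} c"
  have cont: "continuous_on {0..1} v" unfolding v_def by (rule regular_C2_curve_velocity_continuous[OF c])
  have le: "norm (c y - c x) \<le> arc_len c" if "x \<in> {0..1}" "y \<in> {0..1}" "x \<le> y" for x y
  proof -
    have sub: "{x..y} \<subseteq> {0..1}" using that by auto
    have "(v has_integral (c y - c x)) {x..y}"
      unfolding v_def using that(3)
      by (rule fundamental_theorem_of_calculus)
         (use regular_C2_curveD(1)[OF c] sub in \<open>blast intro: has_vector_derivative_within_subset\<close>)
    then have "norm (c y - c x) = norm (integral {x..y} v)" by (simp add: integral_unique)
    also have "\<dots> \<le> integral {x..y} (\<lambda>z. norm (v z))"
      using cont sub by (intro integral_norm_bound_integral integrable_continuous_real continuous_intros)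
        (auto intro: continuous_on_subset)
    also have "\<dots> \<le> integral {0..1} (\<lambda>z. norm (v z))"
      using cont sub
      by (intro integral_subset_le integrable_continuous_real continuous_intros) (auto intro: continuous_on_subset)
    finally show ?thesis by (simp add: arc_len_def v_def)
  qed
  show ?thesis
  proof (cases "u \<le> s")
    case True then show ?thesis using le[OF u s] by simp
  next
    case False then show ?thesis using le[OF s u] by (simp add: norm_minus_commute)
  qed
qed

context level_set_patch
begin

context
  fixes c :: "real \<Rightarrow> real^3"
  assumes geo: "geodesic_arc S n c" and in_ball: "\<And>s. s \<in> {0..1} \<Longrightarrow> c s \<in> cball p R"
begin

lemma geodesic_regular: "regular_C2_curve {0..1} c"
  using geo by (simp add: geodesic_arc_def)

lemma geodesic_on_surface: "s \<in> {0..1} \<Longrightarrow> c s \<in> S"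
  using geo by (auto simp: geodesic_arc_def)

lemma geodesic_acceleration_normal:
  assumes "s \<in> {0..1}"
  shows "velocity {0..1} (velocity {0..1} c) s =
    (velocity {0..1} (velocity {0..1} c) s \<bullet> n (c s)) *\<^sub>R n (c s)"
  using geo assms by (simp add: geodesic_arc_def covariant_derivative_def)

text \<open>Derived from \<open>F \<circ> c = 0\<close> and not from the tangent spaces, because the end points of the
  parameter interval only have one-sided derivatives.\<close>

lemma gradient_inner_velocity:
  assumes s: "s \<in> {0..1}"
  shows "G (c s) \<bullet> velocity {0..1} c s = 0"
proof -
  have "((\<lambda>s. F (c s)) has_vector_derivative G (c s) \<bullet> velocity {0..1} c s) (at s within {0..1})"
    unfolding has_real_derivative_iff_has_vector_derivative[symmetric]
    by (rule F_along_curve[OF regular_C2_curveD(1)[OF geodesic_regular s] in_ball[OF s]])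
  moreover have "((\<lambda>s. F (c s)) has_vector_derivative 0) (at s within {0..1})"
    unfolding has_vector_derivative_def
  proof (rule has_derivative_transform[OF s])
    show "F (c u) = 0" if "u \<in> {0..1}" for u
      using mem_iff[OF in_ball[OF that]] geodesic_on_surface[OF that] by simp
  qed simp
  ultimately show ?thesis
    using vector_derivative_unique_within[OF at_within_unit_interval[OF s]] by blast
qed

lemma normal_inner_velocity:
  assumes s: "s \<in> {0..1}"
  shows "n (c s) \<bullet> velocity {0..1} c s = 0"
proof -
  have 0: "(G (c s) \<bullet> n (c s)) * (n (c s) \<bullet> velocity {0..1} c s) = 0"
    using gradient_inner_velocity[OF s]
      unit_normal_parallel(2)[OF geodesic_on_surface[OF s] in_ball[OF s]]
    by (metis inner_scaleR_left)
  have "G (c s) \<bullet> n (c s) \<noteq> 0"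
    using unit_normal_parallel(3)[OF geodesic_on_surface[OF s] in_ball[OF s]]
      G_nonzero[OF in_ball[OF s]] by auto
  then show ?thesis using 0 by simp
qed

lemma geodesic_constant_speed:
  assumes s: "s \<in> {0..1}"
  shows "norm (velocity {0..1} c s) = arc_len c"
proof -
  define v where "v = velocity {0..1} c"
  define a where "a = velocity {0..1} v"
  have d: "((\<lambda>s. v s \<bullet> v s) has_vector_derivative 0) (at s within {0..1})" if s: "s \<in> {0..1}" for s
  proof -
    have dv: "(v has_derivative (\<lambda>h. h *\<^sub>R a s)) (at s within {0..1})"
      using regular_C2_curveD(2)[OF geodesic_regular s] by (simp add: has_vector_derivative_def v_def a_def)
    have "a s \<bullet> v s = (a s \<bullet> n (c s)) * (n (c s) \<bullet> v s)"
      using geodesic_acceleration_normal[OF s] unfolding a_def v_def by (metis inner_scaleR_left)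
    then have 0: "a s \<bullet> v s = 0" using normal_inner_velocity[OF s] by (simp add: v_def)
    then have "v s \<bullet> a s = 0" by (simp add: inner_commute)
    then show ?thesis
      unfolding has_vector_derivative_def using has_derivative_inner[OF dv dv] 0 by simp
  qed
  have b: "norm (v s \<bullet> v s - v 0 \<bullet> v 0) \<le> 0 * \<bar>s - 0\<bar>" if "s \<in> {0..1}" for s
    by (rule increment_bound_vector_derivative[OF d]) (use that in auto)
  have const: "norm (v s) = norm (v 0)" if "s \<in> {0..1}" for s
  proof -
    have "v s \<bullet> v s = v 0 \<bullet> v 0" using b[OF that] by simp
    then show ?thesis by (simp only: norm_eq)
  qed
  have "arc_len c = integral {0..1} (\<lambda>s::real. norm (v 0))"
    unfolding arc_len_def v_def[symmetric]
    by (rule Henstock_Kurzweil_Integration.integral_cong) (rule const)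
  then show ?thesis using const[OF s] by (simp add: v_def)
qed

text \<open>Differentiating \<open>G c \<bullet> c' = 0\<close> expresses the normal component of the acceleration through the
  Hessian of \<open>F\<close> and the speed, which is the arc length.\<close>

lemma geodesic_acceleration_bound:
  assumes s: "s \<in> {0..1}"
  shows "\<bar>velocity {0..1} (velocity {0..1} c) s \<bullet> n (c s)\<bar> \<le> K / m * (arc_len c)\<^sup>2"
proof -
  define v where "v = velocity {0..1} c"
  define a where "a = velocity {0..1} v"
  note x = geodesic_on_surface[OF s] in_ball[OF s]
  have "((\<lambda>s. G (c s) \<bullet> v s) has_vector_derivative G' (c s) (v s) \<bullet> v s + G (c s) \<bullet> a s) (at s within {0..1})"
    unfolding has_real_derivative_iff_has_vector_derivative[symmetric]
    by (rule gradient_along_curve)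
       (use regular_C2_curveD[OF geodesic_regular s] x in \<open>auto simp: v_def a_def\<close>)
  moreover have "((\<lambda>s. G (c s) \<bullet> v s) has_vector_derivative 0) (at s within {0..1})"
    unfolding has_vector_derivative_def
  proof (rule has_derivative_transform[OF s])
    show "G (c u) \<bullet> v u = 0" if "u \<in> {0..1}" for u
      unfolding v_def by (rule gradient_inner_velocity[OF that])
  qed simp
  ultimately have "G' (c s) (v s) \<bullet> v s + G (c s) \<bullet> a s = 0"
    using vector_derivative_unique_within[OF at_within_unit_interval[OF s]] by blast
  moreover have "G (c s) \<bullet> a s = (G (c s) \<bullet> n (c s)) * (a s \<bullet> n (c s))"
    using geodesic_acceleration_normal[OF s] unfolding a_def v_def by (metis inner_scaleR_right mult.commute)
  ultimately have "\<bar>G (c s) \<bullet> n (c s)\<bar> * \<bar>a s \<bullet> n (c s)\<bar> = \<bar>G' (c s) (v s) \<bullet> v s\<bar>"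
    by (metis abs_mult abs_minus_cancel add_eq_0_iff)
  also have "\<dots> \<le> K * (arc_len c)\<^sup>2"
    using second_form_bound[OF x(2), of "v s"] geodesic_constant_speed[OF s] by (simp add: v_def)
  finally have "norm (G (c s)) * \<bar>a s \<bullet> n (c s)\<bar> \<le> K * (arc_len c)\<^sup>2"
    unfolding unit_normal_parallel(3)[OF x] .
  then have "m * \<bar>a s \<bullet> n (c s)\<bar> \<le> K * (arc_len c)\<^sup>2"
    using mult_right_mono[OF G_lower[OF x(2)], of "\<bar>a s \<bullet> n (c s)\<bar>"] by linarith
  then show ?thesis using m_pos by (simp add: field_simps a_def v_def)
qed

text \<open>The acceleration is normal to \<open>S\<close> at every point of the curve, so its component tangential at the
  point \<open>c s0\<close> carries an additional factor, the oscillation of the Gauss map. Integrating twice shows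
  that the tangential part of the chord is the velocity up to \<open>\<eta> * O(arc_len\<^sup>2)\<close>.\<close>

lemma geodesic_tangential_chord:
  assumes s0: "s0 \<in> {0..1}" and \<eta>: "\<And>s. s \<in> {0..1} \<Longrightarrow> norm (n (c s) - n (c s0)) \<le> \<eta>"
  shows "norm (tangential (n (c s0)) (c 1 - c 0) - velocity {0..1} c s0) \<le> K / m * \<eta> * (arc_len c)\<^sup>2"
proof -
  define v where "v = velocity {0..1} c"
  define a where "a = velocity {0..1} v"
  define B where "B = K / m * \<eta> * (arc_len c)\<^sup>2"
  define T where "T = tangential (n (c s0))"
  have n1: "norm (n (c s0)) = 1"
    by (rule unit_normal_parallel(1)[OF geodesic_on_surface[OF s0] in_ball[OF s0]])
  interpret T: bounded_linear T unfolding T_def by (rule tangential_linear)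
  have aB: "norm (T (a s)) \<le> B" if s: "s \<in> {0..1}" for s
  proof -
    have "T (n (c s)) = T (n (c s) - n (c s0))"
      using tangential_self[OF n1] by (simp add: T.diff T_def[symmetric])
    then have "norm (T (n (c s))) \<le> \<eta>"
      using norm_tangential_le[OF n1] \<eta>[OF s] unfolding T_def by (metis order_trans)
    moreover have "T (a s) = (a s \<bullet> n (c s)) *\<^sub>R T (n (c s))"
      using geodesic_acceleration_normal[OF s] unfolding a_def v_def by (metis T.scaleR)
    moreover have "\<bar>a s \<bullet> n (c s)\<bar> \<le> K / m * (arc_len c)\<^sup>2"
      unfolding a_def v_def by (rule geodesic_acceleration_bound[OF s])
    ultimately have "norm (T (a s)) \<le> (K / m * (arc_len c)\<^sup>2) * \<eta>"
      using K_nonneg m_pos by (simp only: norm_scaleR) (intro mult_mono, auto)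
    then show ?thesis by (simp add: B_def mult_ac)
  qed
  have dT: "((\<lambda>s. T (f s)) has_vector_derivative T w) A" if "(f has_vector_derivative w) A" for f w A
    using T.has_vector_derivative[OF that] .
  have dv: "((\<lambda>s. T (v s)) has_vector_derivative T (a s)) (at s within {0..1})" if "s \<in> {0..1}" for s
    by (rule dT) (use regular_C2_curveD(2)[OF geodesic_regular that] in \<open>simp add: v_def a_def\<close>)
  have B0: "0 \<le> B" using aB[OF s0] norm_ge_zero order_trans by blast
  have vB: "norm (T (v s) - T (v s0)) \<le> B" if s: "s \<in> {0..1}" for s
  proof -
    have "norm (T (v s) - T (v s0)) \<le> B * \<bar>s - s0\<bar>"
      by (rule increment_bound_vector_derivative[OF dv _ aB s0 s]) auto
    also have "\<dots> \<le> B * 1" using s s0 B0 by (intro mult_left_mono) auto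
    finally show ?thesis by simp
  qed
  have dc: "((\<lambda>s. T (c s) - s *\<^sub>R T (v s0)) has_vector_derivative T (v s) - T (v s0)) (at s within {0..1})"
    if "s \<in> {0..1}" for s
    using dT[OF regular_C2_curveD(1)[OF geodesic_regular that]] unfolding v_def
    by (auto intro!: derivative_eq_intros)
  have "norm ((T (c 1) - 1 *\<^sub>R T (v s0)) - (T (c 0) - 0 *\<^sub>R T (v s0))) \<le> B * \<bar>1 - 0\<bar>"
    by (rule increment_bound_vector_derivative[OF dc _ vB]) auto
  moreover have "T (v s0) = v s0"
    unfolding T_def v_def by (rule tangential_orthogonal[OF normal_inner_velocity[OF s0]])
  ultimately have "norm (T (c 1 - c 0) - v s0) \<le> B" by (simp add: T.diff algebra_simps)
  then show ?thesis unfolding B_def T_def v_def .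
qed

end

end

text \<open>The second-order statement about geodesics on which everything rests: seen in the tangent plane at
  \<open>p\<close>, a short geodesic through \<open>p\<close> has no acceleration to second order. It is formulated for an
  arbitrary parameter \<open>s\<close> because \<open>p\<close> is the final point of the first arc of a V-line and the initial
  point of the second one.\<close>

lemma short_geodesic_chord:
  fixes S :: "(real^3) set" and n :: "real^3 \<Rightarrow> real^3" and p :: "real^3"
  assumes S: "smooth_surface S" and n: "gauss_map S n" and p: "p \<in> S" and \<epsilon>: "0 < \<epsilon>"
  shows "\<exists>d>0. \<forall>c. \<forall>s\<in>{0..1}. geodesic_arc S n c \<longrightarrow> c s = p \<longrightarrow> arc_len c < d \<longrightarrow>
    norm (velocity {0..1} c s) = arc_len c \<and> n p \<bullet> velocity {0..1} c s = 0 \<and>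
    norm (tangential (n p) (c 1 - c 0) - velocity {0..1} c s) \<le> \<epsilon> * (arc_len c)\<^sup>2"
proof -
  obtain R m K F G G' where "level_set_patch S n p R m K F G G'"
    by (rule surface_level_set_patch[OF S n p])
  then interpret level_set_patch S n p R m K F G G' .
  define \<eta> where "\<eta> = \<epsilon> / (K / m + 1)"
  have K0: "0 \<le> K / m" using K_nonneg m_pos by simp
  have \<eta>: "0 < \<eta>" using \<epsilon> K0 by (simp add: \<eta>_def)
  have "(K / m + 1) * \<eta> = \<epsilon>" using K0 by (simp add: \<eta>_def)
  then have \<eta>_le: "K / m * \<eta> \<le> \<epsilon>" using \<eta> by (simp only: distrib_right)
  have "continuous_on S n" using n by (simp add: gauss_map_def)
  then obtain d where d: "0 < d" "\<And>x. x \<in> S \<Longrightarrow> dist x p < d \<Longrightarrow> dist (n x) (n p) < \<eta>"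
    using p \<eta> unfolding continuous_on_iff by meson
  have "norm (velocity {0..1} c s) = arc_len c \<and> n p \<bullet> velocity {0..1} c s = 0 \<and>
    norm (tangential (n p) (c 1 - c 0) - velocity {0..1} c s) \<le> \<epsilon> * (arc_len c)\<^sup>2"
    if geo: "geodesic_arc S n c" and s: "s \<in> {0..1}" and cs: "c s = p" and l: "arc_len c < min d R" for c s
  proof -
    have reg: "regular_C2_curve {0..1} c" using geo by (simp add: geodesic_arc_def)
    have near: "norm (c u - p) < min d R" if "u \<in> {0..1}" for u
      using chord_le_arc_len[OF reg that s] l cs by simp
    have in_ball: "c u \<in> cball p R" if "u \<in> {0..1}" for u
      using near[OF that] by (simp add: dist_norm norm_minus_commute)
    have "norm (n (c u) - n (c s)) \<le> \<eta>" if "u \<in> {0..1}" for u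
      using d(2)[OF geodesic_on_surface[OF geo in_ball that]] near[OF that] cs by (simp add: dist_norm)
    from geodesic_tangential_chord[OF geo in_ball s this]
    have "norm (tangential (n p) (c 1 - c 0) - velocity {0..1} c s) \<le> K / m * \<eta> * (arc_len c)\<^sup>2"
      by (simp add: cs)
    also have "\<dots> \<le> \<epsilon> * (arc_len c)\<^sup>2" using \<eta>_le by (intro mult_right_mono) auto
    finally show ?thesis
      using geodesic_constant_speed[OF geo in_ball s] normal_inner_velocity[OF geo in_ball s] cs by simp
  qed
  moreover have "0 < min d R" using d(1) R_pos by simp
  ultimately show ?thesis by blast
qed

section \<open>Geodesic curvature in an arbitrary parameter\<close>

lemma open_interval_neighbourhood:
  fixes I :: "real set" and t u :: real
  assumes "open I" "is_interval I" "t \<in> I" "u \<in> I"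
  obtains lo hi where "lo < t" "lo < u" "t < hi" "u < hi" "{lo..hi} \<subseteq> I"
proof -
  have min: "min t u \<in> I" and max: "max t u \<in> I"
    using assms(3,4) by (simp_all add: min_def max_def)
  obtain e1 where e1: "0 < e1" "cball (min t u) e1 \<subseteq> I"
    using open_contains_cball_eq[OF assms(1)] min by metis
  obtain e2 where e2: "0 < e2" "cball (max t u) e2 \<subseteq> I"
    using open_contains_cball_eq[OF assms(1)] max by metis
  have lo: "min t u - e1 \<in> I" using e1 by (intro subsetD[OF e1(2)]) (simp add: dist_real_def)
  have hi: "max t u + e2 \<in> I" using e2 by (intro subsetD[OF e2(2)]) (simp add: dist_real_def)
  have sub: "{min t u - e1 .. max t u + e2} \<subseteq> I"
    using assms(2) lo hi unfolding is_interval_1 by (meson atLeastAtMost_iff subsetI)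
  show ?thesis
    by (rule that[OF _ _ _ _ sub]) (use e1(1) e2(1) in linarith)+
qed

context
  fixes I :: "real set" and \<sigma> :: "real \<Rightarrow> real^3"
  assumes I: "open I" "is_interval I" and \<sigma>: "regular_C2_curve I \<sigma>"
begin

lemma open_curve_derivatives:
  assumes "u \<in> I"
  shows "(\<sigma> has_vector_derivative velocity I \<sigma> u) (at u)"
    and "(velocity I \<sigma> has_vector_derivative velocity I (velocity I \<sigma>) u) (at u)"
  using regular_C2_curveD(1,2)[OF \<sigma> assms] by (simp_all only: at_within_open[OF assms I(1)])

lemma signed_arc_length_has_derivative:
  assumes t: "t \<in> I" and u: "u \<in> I"
  shows "(signed_arc_length I \<sigma> t has_real_derivative norm (velocity I \<sigma> u)) (at u)"
proof -
  define g where "g = (\<lambda>x. norm (velocity I \<sigma> x))"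
  obtain lo hi where lh: "lo < t" "lo < u" "t < hi" "u < hi" "{lo..hi} \<subseteq> I"
    using open_interval_neighbourhood[OF I t u] .
  have g: "continuous_on {lo..hi} g"
    unfolding g_def using regular_C2_curve_velocity_continuous[OF \<sigma>] lh(5)
    by (intro continuous_intros) (rule continuous_on_subset)
  have int: "g integrable_on {x..y}" if "lo \<le> x" "y \<le> hi" for x y
    using that by (intro integrable_continuous_real continuous_on_subset[OF g]) auto
  \<comment> \<open>One of the two integrals in the definition vanishes; measuring from the common base point \<open>lo\<close>
      removes the case distinction at \<open>t\<close>.\<close>
  have eq: "signed_arc_length I \<sigma> t x = integral {lo..x} g - integral {lo..t} g" if x: "x \<in> {lo..hi}" for x
  proof (cases "t \<le> x")
    case True
    have "integral {lo..t} g + integral {t..x} g = integral {lo..x} g"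
      using True lh x by (intro Henstock_Kurzweil_Integration.integral_combine int) auto
    moreover have "integral {x..t} g = 0" using True by (cases "x = t") auto
    ultimately show ?thesis unfolding signed_arc_length_def g_def[symmetric] by simp
  next
    case False
    have "integral {lo..x} g + integral {x..t} g = integral {lo..t} g"
      using False lh x by (intro Henstock_Kurzweil_Integration.integral_combine int) auto
    moreover have "integral {t..x} g = 0" using False by auto
    ultimately show ?thesis unfolding signed_arc_length_def g_def[symmetric] by simp
  qed
  have "((\<lambda>x. integral {lo..x} g - integral {lo..t} g) has_real_derivative g u) (at u within {lo..hi})"
    using integral_has_real_derivative[OF g, of u] lh by (auto intro!: derivative_eq_intros)
  then have "((\<lambda>x. integral {lo..x} g - integral {lo..t} g) has_real_derivative g u) (at u)"
    using lh at_within_Icc_at[of lo u hi] by simp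
  then have "(signed_arc_length I \<sigma> t has_real_derivative g u) (at u)"
    by (rule has_field_derivative_transform_within_open[where S = "{lo<..<hi}"]) (use lh eq in auto)
  then show ?thesis by (simp add: g_def)
qed

lemma signed_arc_length_strict_mono:
  assumes t: "t \<in> I"
  shows "strict_mono_on I (signed_arc_length I \<sigma> t)"
proof (rule strict_mono_onI)
  fix x y assume xy: "x \<in> I" "y \<in> I" "x < y"
  show "signed_arc_length I \<sigma> t x < signed_arc_length I \<sigma> t y"
  proof (rule DERIV_pos_imp_increasing[OF xy(3)])
    fix u assume "x \<le> u" "u \<le> y"
    then have u: "u \<in> I" using xy I(2) unfolding is_interval_1 by blast
    show "\<exists>y. (signed_arc_length I \<sigma> t has_real_derivative y) (at u) \<and> 0 < y"
      using signed_arc_length_has_derivative[OF t u] regular_C2_curveD(3)[OF \<sigma> u] by auto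
  qed
qed

text \<open>Strict monotonicity and invariance of domain make the arc length parameter interval open, so that
  derivatives within it are ordinary derivatives.\<close>

lemma arc_length_parameter:
  fixes t :: real
  assumes t: "t \<in> I"
  defines "J \<equiv> signed_arc_length I \<sigma> t ` I" and "M \<equiv> inv_into I (signed_arc_length I \<sigma> t)"
  shows "open J" "0 \<in> J" "M 0 = t"
    and "\<And>s. s \<in> J \<Longrightarrow> M s \<in> I"
    and "\<And>s. s \<in> J \<Longrightarrow> (M has_real_derivative inverse (norm (velocity I \<sigma> (M s)))) (at s)"
proof -
  define L where "L = signed_arc_length I \<sigma> t"
  have inj: "inj_on L I"
    unfolding L_def by (rule strict_mono_on_imp_inj_on[OF signed_arc_length_strict_mono[OF t]])
  have dL: "(L has_real_derivative norm (velocity I \<sigma> u)) (at u)" if "u \<in> I" for u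
    unfolding L_def by (rule signed_arc_length_has_derivative[OF t that])
  have cL: "continuous_on I L"
    by (rule continuous_at_imp_continuous_on) (use dL DERIV_isCont in blast)
  have J: "J = L ` I" by (simp add: J_def L_def)
  have M: "M = inv_into I L" by (simp add: M_def L_def)
  show oJ: "open J" unfolding J by (rule invariance_of_domain[OF cL I(1) inj])
  have L0: "L t = 0" by (simp add: L_def signed_arc_length_def)
  show "0 \<in> J" using L0 t unfolding J by force
  show "M 0 = t" unfolding M using inv_into_f_f[OF inj t] L0 by simp
  show MI: "M s \<in> I" if "s \<in> J" for s using that unfolding M J by (rule inv_into_into)
  have LM: "L (M s) = s" if "s \<in> J" for s using that unfolding M J by (rule f_inv_into_f)
  have cM: "continuous_on J M"
    unfolding M J by (rule continuous_on_inverse_open[OF I(1) cL]) (use inv_into_f_f[OF inj] in auto)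
  show "(M has_real_derivative inverse (norm (velocity I \<sigma> (M s)))) (at s)" if s: "s \<in> J" for s
  proof -
    obtain e where e: "0 < e" "ball s e \<subseteq> J" using openE[OF oJ s] .
    show ?thesis
    proof (rule DERIV_inverse_function[where f = L and a = "s - e" and b = "s + e"])
      show "norm (velocity I \<sigma> (M s)) \<noteq> 0" using regular_C2_curveD(3)[OF \<sigma> MI[OF s]] by simp
      show "L (M y) = y" if "s - e < y" "y < s + e" for y
        using that e(2) by (intro LM) (auto simp: subset_iff dist_real_def)
      show "isCont M s" using cM oJ s continuous_on_eq_continuous_at by blast
    qed (use dL[OF MI[OF s]] e(1) in auto)
  qed
qed

text \<open>In the second derivative with respect to arc length, the reparametrization contributes, besides the
  rescaled acceleration, only a multiple of the velocity, and \<open>cross3 n v\<close> is orthogonal to that.\<close>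

lemma geodesic_curvature_eq:
  assumes t: "t \<in> I"
  shows "geodesic_curvature n I \<sigma> t =
    velocity I (velocity I \<sigma>) t \<bullet> cross3 (n (\<sigma> t)) (velocity I \<sigma> t) / norm (velocity I \<sigma> t) ^ 3"
proof -
  define v where "v = velocity I \<sigma>"
  define a where "a = velocity I v"
  define J where "J = signed_arc_length I \<sigma> t ` I"
  define M where "M = inv_into I (signed_arc_length I \<sigma> t)"
  define w where "w u = v u /\<^sub>R norm (v u)" for u
  note par = arc_length_parameter[OF t, folded J_def M_def v_def]
  have v0: "v u \<noteq> 0" if "u \<in> I" for u unfolding v_def by (rule regular_C2_curveD(3)[OF \<sigma> that])
  have d\<sigma>: "(\<sigma> has_vector_derivative v u) (at u)" and dv: "(v has_vector_derivative a u) (at u)" if "u \<in> I" for u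
    using open_curve_derivatives[OF that] by (simp_all add: v_def a_def)
  have comp: "((f \<circ> M) has_vector_derivative inverse (norm (v (M s))) *\<^sub>R f') (at s)"
    if "s \<in> J" "(f has_vector_derivative f') (at (M s))" for f :: "real \<Rightarrow> real^3" and f' s
    using vector_diff_chain_at[of M "inverse (norm (v (M s)))" s f f'] par(5)[OF that(1)] that(2)
    by (simp add: has_real_derivative_iff_has_vector_derivative)
  have vel: "velocity J f s = f'" if "s \<in> J" "(f has_vector_derivative f') (at s)" for f f' s
    using that par(1) unfolding velocity_def
    by (metis at_within_open vector_derivative_at)
  have \<tau>: "velocity J (\<sigma> \<circ> M) s = (w \<circ> M) s" if s: "s \<in> J" for s
    unfolding w_def comp_def using comp[OF s d\<sigma>[OF par(4)[OF s]]] by (intro vel[OF s]) (simp add: comp_def)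
  have "(norm \<circ> v) differentiable (at t)"
    using dv[OF t] v0[OF t]
    by (intro differentiable_chain_at differentiable_norm_at) (auto intro: differentiableI_vector)
  then have "(\<lambda>u. norm (v u)) differentiable (at t)" by (simp only: comp_def)
  then have "(\<lambda>u. inverse (norm (v u))) differentiable (at t)"
    by (rule differentiable_inverse) (use v0[OF t] in simp)
  then obtain D where D: "((\<lambda>u. inverse (norm (v u))) has_real_derivative D) (at t)"
    using real_differentiable_def by blast
  have "(w has_vector_derivative inverse (norm (v t)) *\<^sub>R a t + D *\<^sub>R v t) (at t)"
    unfolding w_def by (rule has_vector_derivative_scaleR[OF D dv[OF t]])
  then have "((w \<circ> M) has_vector_derivative inverse (norm (v t)) *\<^sub>R (inverse (norm (v t)) *\<^sub>R a t + D *\<^sub>R v t)) (at 0)"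
    using comp[OF par(2), of w] par(3) by simp
  then have "(velocity J (\<sigma> \<circ> M) has_vector_derivative inverse (norm (v t)) *\<^sub>R (inverse (norm (v t)) *\<^sub>R a t + D *\<^sub>R v t)) (at 0)"
    by (rule has_vector_derivative_transform_within_open[OF _ par(1) par(2)]) (simp add: \<tau>)
  then have acc: "velocity J (velocity J (\<sigma> \<circ> M)) 0 = inverse (norm (v t)) *\<^sub>R (inverse (norm (v t)) *\<^sub>R a t + D *\<^sub>R v t)"
    by (rule vel[OF par(2)])
  have "geodesic_curvature n I \<sigma> t = velocity J (velocity J (\<sigma> \<circ> M)) 0 \<bullet> cross3 (n (\<sigma> t)) (w t)"
    unfolding geodesic_curvature_def geodesic_curvature_arclength_def J_def[symmetric] M_def[symmetric]
    using \<tau>[OF par(2)] par(3) by simp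
  also have "\<dots> = a t \<bullet> cross3 (n (\<sigma> t)) (v t) / norm (v t) ^ 3"
    unfolding acc w_def
    by (simp add: cross_mult_right inner_add_left dot_cross_self power3_eq_cube divide_inverse mult_ac)
  finally show ?thesis by (simp add: v_def a_def)
qed

text \<open>Mean value inequality for the difference of the curve and its Taylor polynomial, whose derivative
  is \<open>o(h)\<close> because the velocity is differentiable at \<open>t\<close>.\<close>

lemma second_order_taylor:
  assumes t: "t \<in> I"
  shows "((\<lambda>h. (\<sigma> (t + h) - \<sigma> t - h *\<^sub>R velocity I \<sigma> t) /\<^sub>R h\<^sup>2)
     \<longlongrightarrow> (1/2) *\<^sub>R velocity I (velocity I \<sigma>) t) (at 0)"
proof (rule tendstoI)
  define v where "v = velocity I \<sigma>"
  define a where "a = velocity I v t"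
  fix \<epsilon> :: real assume \<epsilon>: "0 < \<epsilon>"
  obtain d1 where d1: "0 < d1" "ball t d1 \<subseteq> I" using openE[OF I(1) t] .
  have "(v has_derivative (\<lambda>h. h *\<^sub>R a)) (at t)"
    using open_curve_derivatives(2)[OF t] by (simp add: has_vector_derivative_def v_def a_def)
  then obtain d2 where d2: "0 < d2"
    "\<And>y. norm (y - t) < d2 \<Longrightarrow> norm (v y - v t - (y - t) *\<^sub>R a) \<le> \<epsilon> / 2 * norm (y - t)"
    using \<epsilon> unfolding has_derivative_at_alt by (meson half_gt_zero)
  define d where "d = min d1 d2"
  have d: "0 < d" using d1 d2 by (simp add: d_def)
  have "dist ((\<sigma> (t + h) - \<sigma> t - h *\<^sub>R v t) /\<^sub>R h\<^sup>2) ((1/2) *\<^sub>R a) < \<epsilon>" if h: "h \<noteq> 0" "\<bar>h\<bar> < d" for h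
  proof -
    define f where "f x = \<sigma> (t + x) - x *\<^sub>R v t - (x\<^sup>2 / 2) *\<^sub>R a" for x
    define A where "A = {-\<bar>h\<bar>..\<bar>h\<bar>}"
    have df: "(f has_vector_derivative v (t + x) - v t - x *\<^sub>R a) (at x within A)" if "x \<in> A" for x
    proof -
      have "t + x \<in> I" using that h d1 by (auto simp: A_def d_def subset_iff dist_real_def)
      then have d\<sigma>: "(\<sigma> has_vector_derivative v (t + x)) (at (t + x))"
        using open_curve_derivatives(1) by (simp add: v_def)
      have "((\<lambda>x. t + x) has_real_derivative 1) (at x)"
        by (auto intro!: derivative_eq_intros)
      then have "((\<lambda>x. \<sigma> (t + x)) has_vector_derivative v (t + x)) (at x)"
        using vector_diff_chain_at[of "\<lambda>x. t + x" 1 x \<sigma> "v (t + x)"] d\<sigma>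
        by (simp add: comp_def has_real_derivative_iff_has_vector_derivative)
      then have "(f has_vector_derivative v (t + x) - v t - x *\<^sub>R a) (at x)"
        unfolding f_def by (auto intro!: derivative_eq_intros simp: power2_eq_square)
      then show ?thesis by (rule has_vector_derivative_at_within)
    qed
    have "norm (f h - f 0) \<le> \<epsilon> / 2 * \<bar>h\<bar> * \<bar>h - 0\<bar>"
    proof (rule increment_bound_vector_derivative[OF df])
      fix x assume x: "x \<in> A"
      have "norm (v (t + x) - v t - (t + x - t) *\<^sub>R a) \<le> \<epsilon> / 2 * norm (t + x - t)"
        using x h by (intro d2(2)) (auto simp: A_def d_def)
      also have "\<dots> \<le> \<epsilon> / 2 * \<bar>h\<bar>" using x \<epsilon> by (intro mult_left_mono) (auto simp: A_def)
      finally show "norm (v (t + x) - v t - x *\<^sub>R a) \<le> \<epsilon> / 2 * \<bar>h\<bar>" by simp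
    qed (auto simp: A_def)
    also have "\<dots> = \<epsilon> / 2 * h\<^sup>2" by (simp add: power2_eq_square)
    also have "\<dots> < \<epsilon> * h\<^sup>2" using \<epsilon> h(1) by simp
    finally have *: "norm (f h - f 0) < \<epsilon> * h\<^sup>2" .
    have eq: "(\<sigma> (t + h) - \<sigma> t - h *\<^sub>R v t) /\<^sub>R h\<^sup>2 - (1/2) *\<^sub>R a = (f h - f 0) /\<^sub>R h\<^sup>2"
      using h(1) by (simp add: f_def algebra_simps)
    have "dist ((\<sigma> (t + h) - \<sigma> t - h *\<^sub>R v t) /\<^sub>R h\<^sup>2) ((1/2) *\<^sub>R a) = norm (f h - f 0) / h\<^sup>2"
      unfolding dist_norm eq norm_scaleR
      by (simp only: abs_inverse abs_power2 mult.commute divide_inverse)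
    also have "\<dots> < \<epsilon>" using * h(1) by (simp add: pos_divide_less_eq)
    finally show ?thesis .
  qed
  then show "\<forall>\<^sub>F h in at 0. dist ((\<sigma> (t + h) - \<sigma> t - h *\<^sub>R velocity I \<sigma> t) /\<^sub>R h\<^sup>2)
      ((1/2) *\<^sub>R velocity I (velocity I \<sigma>) t) < \<epsilon>"
    using d unfolding eventually_at v_def a_def by (auto simp: dist_real_def)
qed

end

section \<open>Asymptotics of signed angles\<close>

lemma orthonormal_frame_decomposition:
  fixes m u v :: "real^3"
  assumes "norm m = 1" "norm u = 1" "m \<bullet> u = 0" "m \<bullet> v = 0"
  shows "v = (u \<bullet> v) *\<^sub>R u + (v \<bullet> cross3 m u) *\<^sub>R cross3 m u"
proof -
  define e where "e = cross3 m u"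
  have "(norm e)\<^sup>2 = 1"
    using norm_cross_dot[of m u] assms by (simp add: e_def)
  then have ee: "e \<bullet> e = 1" by (simp add: power2_norm_eq_inner)
  \<comment> \<open>Expanding \<open>e \<times> (v \<times> e)\<close> in two ways by the triple product formula gives the decomposition.\<close>
  have "cross3 v e = (u \<bullet> v) *\<^sub>R m"
    unfolding e_def Lagrange using assms(4) by (simp add: inner_commute)
  moreover have "cross3 e m = u"
  proof -
    have "cross3 m e = - u"
      unfolding e_def Lagrange using assms by (simp add: norm_eq_1)
    then show ?thesis by (subst cross_skew) simp
  qed
  ultimately have "cross3 e (cross3 v e) = (u \<bullet> v) *\<^sub>R u" by (simp add: cross_mult_right)
  moreover have "cross3 e (cross3 v e) = v - (v \<bullet> e) *\<^sub>R e"
    unfolding Lagrange using ee by (simp add: inner_commute)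
  ultimately show ?thesis by (simp add: e_def algebra_simps)
qed

text \<open>The sign condition \<open>0 < u \<bullet> v\<close> confines the angle to the interval on which it is determined by
  its sine; the sine is the triple product of the unit vectors.\<close>

lemma signed_angle_eq_arcsin:
  fixes m u v :: "real^3"
  assumes m: "norm m = 1" and mu: "m \<bullet> u = 0" and mv: "m \<bullet> v = 0" and uv: "0 < u \<bullet> v"
  shows "signed_angle m u v = arcsin (m \<bullet> cross3 u v / (norm u * norm v))"
proof -
  have nz: "u \<noteq> 0" "v \<noteq> 0" using uv by auto
  define U where "U = u /\<^sub>R norm u"
  define V where "V = v /\<^sub>R norm v"
  define e where "e = cross3 m U"
  define y where "y = m \<bullet> cross3 u v / (norm u * norm v)"
  have U1: "norm U = 1" and V1: "norm V = 1" using nz by (simp_all add: U_def V_def)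
  have mU: "m \<bullet> U = 0" and mV: "m \<bullet> V = 0" using mu mv by (simp_all add: U_def V_def)
  have x: "0 < U \<bullet> V" using uv nz by (simp add: U_def V_def)
  have "V \<bullet> e = m \<bullet> cross3 U V" unfolding e_def by (simp add: cross3_simps)
  also have "\<dots> = y"
    by (simp add: y_def U_def V_def cross_mult_left cross_mult_right divide_inverse mult_ac)
  finally have y: "V \<bullet> e = y" .
  have dec: "V = (U \<bullet> V) *\<^sub>R U + y *\<^sub>R e"
    using orthonormal_frame_decomposition[OF m U1 mU mV] y by (simp add: e_def)
  have UU: "U \<bullet> U = 1" using U1 by (simp add: norm_eq_1)
  have Ue: "U \<bullet> e = 0" by (simp add: e_def dot_cross_self)
  have "(norm e)\<^sup>2 = 1" using norm_cross_dot[of m U] m U1 mU by (simp add: e_def)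
  then have ee: "e \<bullet> e = 1" by (simp add: power2_norm_eq_inner)
  have comp: "U \<bullet> (c *\<^sub>R U + s *\<^sub>R e) = c" "(c *\<^sub>R U + s *\<^sub>R e) \<bullet> e = s" for c s
    using UU Ue ee by (simp_all add: inner_add_left inner_add_right)
  have "V \<bullet> V = (U \<bullet> V)\<^sup>2 + y\<^sup>2"
  proof -
    have "V \<bullet> V = V \<bullet> ((U \<bullet> V) *\<^sub>R U + y *\<^sub>R e)" using dec by simp
    then show ?thesis using y by (simp add: inner_add_right inner_commute power2_eq_square)
  qed
  then have sq: "(U \<bullet> V)\<^sup>2 = 1 - y\<^sup>2" using V1 by (simp add: norm_eq_1)
  then have "y\<^sup>2 \<le> 1" using zero_le_power2[of "U \<bullet> V"] by linarith
  then have yb: "-1 \<le> y" "y \<le> 1" using abs_le_square_iff[of y 1] by (simp_all add: abs_le_iff)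
  have cos: "cos (arcsin y) = U \<bullet> V"
    using cos_arcsin[OF yb] sq x by (metis real_sqrt_unique less_imp_le)
  have "signed_angle m u v = arcsin y"
    unfolding signed_angle_def U_def[symmetric] V_def[symmetric] e_def[symmetric]
  proof (rule the_equality, intro conjI)
    show "- pi < arcsin y" "arcsin y \<le> pi"
      using arcsin_bounded[OF yb] pi_gt_zero by linarith+
    show "V = cos (arcsin y) *\<^sub>R U + sin (arcsin y) *\<^sub>R e"
      unfolding cos sin_arcsin[OF yb] by (rule dec)
  next
    fix \<delta> assume \<delta>: "- pi < \<delta> \<and> \<delta> \<le> pi \<and> V = cos \<delta> *\<^sub>R U + sin \<delta> *\<^sub>R e"
    have c: "cos \<delta> = U \<bullet> V" and s: "sin \<delta> = y"
      using comp[of "cos \<delta>" "sin \<delta>"] \<delta> y by simp_all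
    have "\<bar>\<delta>\<bar> < pi / 2"
    proof (rule ccontr)
      assume "\<not> \<bar>\<delta>\<bar> < pi / 2"
      then have "cos \<bar>\<delta>\<bar> \<le> cos (pi / 2)" using \<delta> by (intro cos_monotone_0_pi_le) auto
      then show False using c x by simp
    qed
    then have "arcsin (sin \<delta>) = \<delta>" by (intro arcsin_sin) auto
    then show "\<delta> = arcsin y" by (simp add: s)
  qed
  then show ?thesis by (simp add: y_def)
qed

text \<open>The case \<open>y = 0\<close> occurs whenever the two directions at the vertex coincide, so the quotient \<open>arcsin y / y\<close> is
  extended continuously by \<open>1\<close>.\<close>

lemma arcsin_quotient_limit:
  fixes y L :: "'b \<Rightarrow> real"
  assumes y: "(y \<longlongrightarrow> 0) F" and q: "((\<lambda>x. y x / L x) \<longlongrightarrow> q) F"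
  shows "((\<lambda>x. arcsin (y x) / L x) \<longlongrightarrow> q) F"
proof -
  define g where "g z = (if z = 0 then 1 else arcsin z / z)" for z :: real
  have "(arcsin has_real_derivative inverse (sqrt (1 - 0\<^sup>2))) (at 0)"
    by (rule DERIV_arcsin) auto
  then have "((\<lambda>z. arcsin z / z) \<longlongrightarrow> 1) (at 0)"
    by (simp add: has_field_derivative_iff)
  then have "(g \<longlongrightarrow> 1) (at 0)"
    by (rule Lim_transform_eventually) (simp add: g_def eventually_at_filter)
  then have "isCont g 0" by (simp add: isCont_def g_def)
  then have "((\<lambda>x. g (y x)) \<longlongrightarrow> g 0) F" by (rule isCont_tendsto_compose[OF _ y])
  then have "((\<lambda>x. g (y x) * (y x / L x)) \<longlongrightarrow> 1 * q) F"
    by (intro tendsto_mult q) (simp add: g_def)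
  moreover have "g z * (z / l) = arcsin z / l" for z l by (simp add: g_def)
  ultimately show ?thesis by (simp only: mult_1)
qed

text \<open>The weights need not converge: a mean of two quantities with a common limit is as close to it as the
  worse of them.\<close>

lemma weighted_mean_limit:
  fixes f g h k :: "'b \<Rightarrow> real"
  assumes f: "(f \<longlongrightarrow> l) F" and g: "(g \<longlongrightarrow> l) F"
    and pos: "eventually (\<lambda>x. 0 < h x \<and> 0 < k x) F"
  shows "((\<lambda>x. (h x * f x + k x * g x) / (h x + k x)) \<longlongrightarrow> l) F"
proof -
  have "((\<lambda>x. (h x * f x + k x * g x) / (h x + k x) - l) \<longlongrightarrow> 0) F"
  proof (rule Lim_null_comparison)
    show "\<forall>\<^sub>F x in F. norm ((h x * f x + k x * g x) / (h x + k x) - l) \<le> \<bar>f x - l\<bar> + \<bar>g x - l\<bar>"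
      using pos
    proof eventually_elim
      case (elim x)
      have "(h x * f x + k x * g x) / (h x + k x) - l
          = (h x / (h x + k x)) * (f x - l) + (k x / (h x + k x)) * (g x - l)"
        using elim by (simp add: divide_simps) (simp add: algebra_simps)
      also have "\<bar>\<dots>\<bar> \<le> h x / (h x + k x) * \<bar>f x - l\<bar> + k x / (h x + k x) * \<bar>g x - l\<bar>"
        using elim by (intro order_trans[OF abs_triangle_ineq]) (simp add: abs_mult)
      also have "\<dots> \<le> 1 * \<bar>f x - l\<bar> + 1 * \<bar>g x - l\<bar>"
        using elim by (intro add_mono mult_right_mono) auto
      finally show ?case by simp
    qed
    have "((\<lambda>x. \<bar>f x - l\<bar> + \<bar>g x - l\<bar>) \<longlongrightarrow> \<bar>l - l\<bar> + \<bar>l - l\<bar>) F"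
      by (intro tendsto_intros f g)
    then show "((\<lambda>x. \<bar>f x - l\<bar> + \<bar>g x - l\<bar>) \<longlongrightarrow> 0) F" by simp
  qed
  then show ?thesis by (rule LIM_zero_cancel)
qed

lemma tendsto_cross3 [tendsto_intros]:
  fixes f g :: "'b \<Rightarrow> real^3"
  assumes "(f \<longlongrightarrow> a) F" "(g \<longlongrightarrow> b) F"
  shows "((\<lambda>x. cross3 (f x) (g x)) \<longlongrightarrow> cross3 a b) F"
proof -
  have "bounded_bilinear cross3"
    using bilinear_cross by (simp add: bilinear_conv_bounded_bilinear)
  then show ?thesis using assms by (rule bounded_bilinear.tendsto)
qed

text \<open>Write \<open>w1 = h1 x1\<close> and \<open>w2 = h2 x2\<close>, where \<open>x1\<close> and \<open>x2\<close> tend to \<open>a\<close>. The sine of the angle is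
  \<open>m \<bullet> (x1 \<times> x2) / (|x1| |x2|)\<close>. The zeroth-order term \<open>a \<times> a\<close> cancels, and the first-order terms of
  the numerator form the combination \<open>h1 A1 + h2 A2\<close> in which \<open>A1\<close> and \<open>A2\<close> have the same limit. The
  sum of the lengths has the same shape. Dividing both by \<open>h1 + h2\<close> leaves weighted means, so the
  limit exists although the ratio of \<open>h1\<close> and \<open>h2\<close> is arbitrary.\<close>

lemma signed_angle_over_length_limit:
  fixes h1 h2 :: "'b \<Rightarrow> real" and w1 w2 :: "'b \<Rightarrow> real^3" and a b m :: "real^3"
  assumes m: "norm m = 1" and a: "a \<noteq> 0"
    and orth: "\<forall>\<^sub>F x in F. m \<bullet> w1 x = 0 \<and> m \<bullet> w2 x = 0"
    and pos: "\<forall>\<^sub>F x in F. 0 < h1 x \<and> 0 < h2 x"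
    and h1: "(h1 \<longlongrightarrow> 0) F" and h2: "(h2 \<longlongrightarrow> 0) F"
    and w1: "((\<lambda>x. (w1 x - h1 x *\<^sub>R a) /\<^sub>R (h1 x)\<^sup>2) \<longlongrightarrow> - b) F"
    and w2: "((\<lambda>x. (w2 x - h2 x *\<^sub>R a) /\<^sub>R (h2 x)\<^sup>2) \<longlongrightarrow> b) F"
  shows "((\<lambda>x. 2 * signed_angle m (w1 x) (w2 x) / (norm (w1 x) + norm (w2 x)))
     \<longlongrightarrow> 2 * (b \<bullet> cross3 m a) / norm a ^ 3) F"
proof -
  define z1 where "z1 x = (w1 x - h1 x *\<^sub>R a) /\<^sub>R (h1 x)\<^sup>2" for x
  define z2 where "z2 x = (w2 x - h2 x *\<^sub>R a) /\<^sub>R (h2 x)\<^sup>2" for x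
  define x1 where "x1 x = a + h1 x *\<^sub>R z1 x" for x
  define x2 where "x2 x = a + h2 x *\<^sub>R z2 x" for x
  have z: "(z1 \<longlongrightarrow> - b) F" "(z2 \<longlongrightarrow> b) F"
    using w1 w2 by (simp_all add: z1_def[abs_def] z2_def[abs_def])
  have "((\<lambda>x. a + h1 x *\<^sub>R z1 x) \<longlongrightarrow> a + 0 *\<^sub>R (- b)) F" by (intro tendsto_intros h1 z)
  then have x1: "(x1 \<longlongrightarrow> a) F" by (simp add: x1_def[abs_def])
  have "((\<lambda>x. a + h2 x *\<^sub>R z2 x) \<longlongrightarrow> a + 0 *\<^sub>R b) F" by (intro tendsto_intros h2 z)
  then have x2: "(x2 \<longlongrightarrow> a) F" by (simp add: x2_def[abs_def])
  have cancel: "u *\<^sub>R u *\<^sub>R (v /\<^sub>R u\<^sup>2) = v" if "0 < u" for u and v :: "real^3"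
  proof -
    have "u * (u * inverse (u\<^sup>2)) = 1" using that by (simp add: power2_eq_square field_simps)
    then show ?thesis by (simp only: scaleR_scaleR scaleR_one)
  qed
  have w: "\<forall>\<^sub>F x in F. w1 x = h1 x *\<^sub>R x1 x \<and> w2 x = h2 x *\<^sub>R x2 x"
    using pos
  proof eventually_elim
    case (elim x)
    then show ?case
      by (simp only: x1_def x2_def z1_def z2_def scaleR_add_right cancel) simp
  qed
  have "((\<lambda>x. x1 x \<bullet> x2 x) \<longlongrightarrow> a \<bullet> a) F" by (intro tendsto_intros x1 x2)
  then have dot: "\<forall>\<^sub>F x in F. 0 < x1 x \<bullet> x2 x"
    by (rule order_tendstoD(1)) (use a in simp)
  define N where "N x = norm (x1 x) * norm (x2 x)" for x
  define y where "y x = m \<bullet> cross3 (x1 x) (x2 x) / N x" for x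
  have "((\<lambda>x. norm (x1 x) * norm (x2 x)) \<longlongrightarrow> norm a * norm a) F"
    by (intro tendsto_intros x1 x2)
  then have N: "(N \<longlongrightarrow> norm a * norm a) F" by (simp add: N_def[abs_def])
  have na: "norm a * norm a \<noteq> 0" using a by simp
  have "((\<lambda>x. m \<bullet> cross3 (x1 x) (x2 x) / N x) \<longlongrightarrow> m \<bullet> cross3 a a / (norm a * norm a)) F"
    by (intro tendsto_intros x1 x2 N na)
  then have y: "(y \<longlongrightarrow> 0) F" by (simp add: y_def[abs_def])
  define A1 where "A1 x = m \<bullet> cross3 (z1 x) a" for x
  define A2 where "A2 x = m \<bullet> cross3 a (z2 x) + h1 x * (m \<bullet> cross3 (z1 x) (z2 x))" for x
  have "((\<lambda>x. m \<bullet> cross3 (z1 x) a) \<longlongrightarrow> m \<bullet> cross3 (- b) a) F" by (intro tendsto_intros z)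
  moreover have "m \<bullet> cross3 (- b) a = b \<bullet> cross3 m a" by (simp add: cross3_simps)
  ultimately have A1: "(A1 \<longlongrightarrow> b \<bullet> cross3 m a) F" by (simp add: A1_def[abs_def])
  have "((\<lambda>x. m \<bullet> cross3 a (z2 x) + h1 x * (m \<bullet> cross3 (z1 x) (z2 x)))
      \<longlongrightarrow> m \<bullet> cross3 a b + 0 * (m \<bullet> cross3 (- b) b)) F" by (intro tendsto_intros z h1)
  moreover have "m \<bullet> cross3 a b = b \<bullet> cross3 m a" by (simp add: cross3_simps)
  ultimately have A2: "(A2 \<longlongrightarrow> b \<bullet> cross3 m a) F" by (simp add: A2_def[abs_def])
  have n1: "((\<lambda>x. norm (x1 x)) \<longlongrightarrow> norm a) F" and n2: "((\<lambda>x. norm (x2 x)) \<longlongrightarrow> norm a) F"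
    by (intro tendsto_intros x1 x2)+
  define L where "L x = norm (w1 x) + norm (w2 x)" for x
  have "((\<lambda>x. ((h1 x * A1 x + h2 x * A2 x) / (h1 x + h2 x)) / N x
        / ((h1 x * norm (x1 x) + h2 x * norm (x2 x)) / (h1 x + h2 x)))
      \<longlongrightarrow> (b \<bullet> cross3 m a) / (norm a * norm a) / norm a) F"
    by (intro tendsto_divide weighted_mean_limit[OF A1 A2 pos] weighted_mean_limit[OF n1 n2 pos] N na)
       (use a in simp)
  moreover have "\<forall>\<^sub>F x in F. ((h1 x * A1 x + h2 x * A2 x) / (h1 x + h2 x)) / N x
        / ((h1 x * norm (x1 x) + h2 x * norm (x2 x)) / (h1 x + h2 x)) = y x / L x"
    using pos w
  proof eventually_elim
    case (elim x)
    have "m \<bullet> cross3 (x1 x) (x2 x) = h1 x * A1 x + h2 x * A2 x"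
      unfolding x1_def x2_def A1_def A2_def
      by (simp add: cross_add_left cross_add_right cross_mult_left cross_mult_right inner_add_right algebra_simps)
    moreover have "L x = h1 x * norm (x1 x) + h2 x * norm (x2 x)"
      using elim by (simp add: L_def)
    ultimately show ?case using elim by (simp add: y_def)
  qed
  ultimately have "((\<lambda>x. y x / L x) \<longlongrightarrow> (b \<bullet> cross3 m a) / (norm a * norm a) / norm a) F"
    by (rule Lim_transform_eventually)
  from tendsto_mult[OF tendsto_const[of 2] arcsin_quotient_limit[OF y this]]
  have "((\<lambda>x. 2 * (arcsin (y x) / L x)) \<longlongrightarrow> 2 * (b \<bullet> cross3 m a) / norm a ^ 3) F"
    by (simp add: power3_eq_cube)
  moreover have "\<forall>\<^sub>F x in F. 2 * (arcsin (y x) / L x) = 2 * signed_angle m (w1 x) (w2 x) / L x"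
    using pos w dot orth
  proof eventually_elim
    case (elim x)
    have "0 < w1 x \<bullet> w2 x" using elim by simp
    then have "signed_angle m (w1 x) (w2 x) = arcsin (m \<bullet> cross3 (w1 x) (w2 x) / (norm (w1 x) * norm (w2 x)))"
      using elim by (intro signed_angle_eq_arcsin m) auto
    also have "m \<bullet> cross3 (w1 x) (w2 x) / (norm (w1 x) * norm (w2 x)) = y x"
      using elim by (simp add: y_def N_def cross_mult_left cross_mult_right)
    finally show ?case by simp
  qed
  ultimately have "((\<lambda>x. 2 * signed_angle m (w1 x) (w2 x) / L x) \<longlongrightarrow> 2 * (b \<bullet> cross3 m a) / norm a ^ 3) F"
    by (rule Lim_transform_eventually)
  then show ?thesis by (simp add: L_def)
qed

text \<open>The error is measured in terms of \<open>|w|\<close>, so the point is to bound \<open>|w|\<close> by a multiple of \<open>h\<close>: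
  from \<open>|q - w| \<le> |w|\<^sup>2\<close> and \<open>|w| < 1/2\<close> one gets \<open>|w| \<le> 2 |q|\<close>, and \<open>q / h\<close> tends to \<open>a\<close>.\<close>

lemma second_order_expansion_transfer:
  fixes h :: "'b \<Rightarrow> real" and q w :: "'b \<Rightarrow> 'a::real_normed_vector"
  assumes pos: "\<forall>\<^sub>F x in F. 0 < h x" and h: "(h \<longlongrightarrow> 0) F"
    and q: "((\<lambda>x. (q x - h x *\<^sub>R a) /\<^sub>R (h x)\<^sup>2) \<longlongrightarrow> b) F"
    and w0: "((\<lambda>x. norm (w x)) \<longlongrightarrow> 0) F"
    and close: "\<And>\<epsilon>. 0 < \<epsilon> \<Longrightarrow> \<forall>\<^sub>F x in F. norm (q x - w x) \<le> \<epsilon> * (norm (w x))\<^sup>2"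
  shows "((\<lambda>x. (w x - h x *\<^sub>R a) /\<^sub>R (h x)\<^sup>2) \<longlongrightarrow> b) F"
proof -
  have "((\<lambda>x. a + h x *\<^sub>R ((q x - h x *\<^sub>R a) /\<^sub>R (h x)\<^sup>2)) \<longlongrightarrow> a + 0 *\<^sub>R b) F"
    by (intro tendsto_intros h q)
  moreover have "\<forall>\<^sub>F x in F. a + h x *\<^sub>R ((q x - h x *\<^sub>R a) /\<^sub>R (h x)\<^sup>2) = q x /\<^sub>R h x"
    using pos
  proof eventually_elim
    case (elim x)
    then have "h x * inverse ((h x)\<^sup>2) = inverse (h x)" "h x * (inverse ((h x)\<^sup>2) * h x) = 1"
      by (simp_all add: power2_eq_square field_simps)
    then show ?case by (simp only: scaleR_scaleR scaleR_diff_right) simp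
  qed
  ultimately have "((\<lambda>x. q x /\<^sub>R h x) \<longlongrightarrow> a) F"
    by (simp add: tendsto_cong)
  then have "((\<lambda>x. norm (q x /\<^sub>R h x)) \<longlongrightarrow> norm a) F" by (rule tendsto_norm)
  then have qb: "\<forall>\<^sub>F x in F. norm (q x /\<^sub>R h x) < norm a + 1"
    by (rule order_tendstoD) simp
  define C where "C = 2 * (norm a + 1)"
  have C: "0 < C" by (simp add: C_def add_nonneg_pos)
  have w_small: "\<forall>\<^sub>F x in F. norm (w x) < 1/2" by (rule order_tendstoD(2)[OF w0]) simp
  have wb: "\<forall>\<^sub>F x in F. norm (w x) \<le> C * h x"
    using qb pos w_small close[OF zero_less_one]
  proof eventually_elim
    case (elim x)
    have "norm (q x) \<le> (norm a + 1) * h x"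
      using elim(1,2) by (simp add: divide_simps mult.commute less_imp_le)
    moreover have "norm (w x) \<le> norm (q x) + norm (q x - w x)"
      using norm_triangle_ineq4[of "q x" "q x - w x"] by simp
    moreover have "norm (q x - w x) \<le> norm (w x) * norm (w x)"
      using elim by (simp add: power2_eq_square)
    moreover have "norm (w x) * norm (w x) \<le> 1/2 * norm (w x)"
      using elim by (intro mult_right_mono) auto
    ultimately show ?case unfolding C_def by linarith
  qed
  have "((\<lambda>x. (w x - q x) /\<^sub>R (h x)\<^sup>2) \<longlongrightarrow> 0) F"
  proof (rule tendstoI)
    fix \<epsilon> :: real assume \<epsilon>: "0 < \<epsilon>"
    define \<epsilon>' where "\<epsilon>' = \<epsilon> / (2 * C\<^sup>2)"
    have \<epsilon>': "0 < \<epsilon>'" "\<epsilon>' * C\<^sup>2 < \<epsilon>" using \<epsilon> C by (simp_all add: \<epsilon>'_def)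
    show "\<forall>\<^sub>F x in F. dist ((w x - q x) /\<^sub>R (h x)\<^sup>2) 0 < \<epsilon>"
      using close[OF \<epsilon>'(1)] wb pos
    proof eventually_elim
      case (elim x)
      have "norm (w x - q x) \<le> \<epsilon>' * (norm (w x))\<^sup>2" using elim(1) by (simp add: norm_minus_commute)
      also have "\<dots> \<le> \<epsilon>' * (C * h x)\<^sup>2" using elim \<epsilon>' by (intro mult_left_mono power_mono) auto
      also have "\<dots> = (\<epsilon>' * C\<^sup>2) * (h x)\<^sup>2" by (simp add: power_mult_distrib)
      also have "\<dots> < \<epsilon> * (h x)\<^sup>2" using \<epsilon>'(2) elim by (intro mult_strict_right_mono) auto
      finally show ?case using elim by (simp add: divide_simps mult.commute)
    qed
  qed
  from tendsto_add[OF q this] show ?thesis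
    by (simp add: scaleR_add_right[symmetric])
qed

section \<open>Inscribed V-lines\<close>

text \<open>Near \<open>t\<close> the curve stays in the ball in which points can be joined by geodesics, and since its
  velocity is not zero it does not return to \<open>\<sigma> t\<close>; so the existence result for geodesics between two
  distinct points applies.\<close>

lemma short_inscribed_V_lines_exist:
  fixes S :: "(real^3) set" and n :: "real^3 \<Rightarrow> real^3" and I :: "real set" and \<sigma> :: "real \<Rightarrow> real^3" and t d :: real
  assumes S: "smooth_surface S" and n: "gauss_map S n" and I: "open I" "is_interval I"
    and \<sigma>: "\<sigma> ` I \<subseteq> S" "regular_C2_curve I \<sigma>" and t: "t \<in> I" and d: "0 < d"
  shows "\<exists>e>0. \<forall>s1\<in>{t - e<..<t}. \<forall>s2\<in>{t<..<t + e}. \<exists>c1 c2.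
            (s1, s2, c1, c2) \<in> inscribed_V_lines S n I \<sigma> t \<and> arc_len c1 < d \<and> arc_len c2 < d"
proof -
  define p where "p = \<sigma> t"
  have p: "p \<in> S" using \<sigma>(1) t by (auto simp: p_def)
  obtain R m K F G G' where "level_set_patch S n p R m K F G G'"
    by (rule surface_level_set_patch[OF S n p])
  then interpret level_set_patch S n p R m K F G G' .
  obtain \<rho> where \<rho>: "0 < \<rho>" and geo: "\<forall>a\<in>S \<inter> ball p \<rho>. \<forall>b\<in>S \<inter> ball p \<rho>. a \<noteq> b \<longrightarrow>
     (\<exists>c. geodesic_arc S n c \<and> c 0 = a \<and> c 1 = b \<and> arc_len c \<le> 3 * norm (b - a))"
    using short_geodesics_exist by (elim exE conjE) (rule that)
  define a where "a = velocity I \<sigma> t"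
  have a0: "0 < norm a" using regular_C2_curveD(3)[OF \<sigma>(2) t] by (simp add: a_def)
  have d\<sigma>: "(\<sigma> has_vector_derivative a) (at t)"
    unfolding a_def by (rule open_curve_derivatives(1)[OF I \<sigma>(2) t])
  obtain e0 where e0: "0 < e0" "ball t e0 \<subseteq> I" using openE[OF I(1) t] .
  have "isCont \<sigma> t" using d\<sigma> by (rule has_vector_derivative_continuous)
  moreover have "0 < min \<rho> (d / 3)" using \<rho> d by simp
  ultimately obtain e1 where e1: "0 < e1" "\<And>s. dist s t < e1 \<Longrightarrow> dist (\<sigma> s) (\<sigma> t) < min \<rho> (d / 3)"
    unfolding continuous_at_eps_delta by metis
  have "0 < norm a / 2" using a0 by simp
  then obtain e2 where e2: "0 < e2"
    "\<And>s. norm (s - t) < e2 \<Longrightarrow> norm (\<sigma> s - \<sigma> t - (s - t) *\<^sub>R a) \<le> norm a / 2 * norm (s - t)"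
    using d\<sigma> unfolding has_vector_derivative_def has_derivative_at_alt by metis
  define e where "e = min e0 (min e1 e2)"
  have e: "0 < e" using e0 e1 e2 by (simp add: e_def)
  have near: "s \<in> I \<and> \<sigma> s \<in> S \<inter> ball p \<rho> \<and> 3 * norm (\<sigma> s - p) < d \<and> \<sigma> s \<noteq> p"
    if s: "s \<noteq> t" "\<bar>s - t\<bar> < e" for s
  proof (intro conjI)
    have "s \<in> ball t e0" using s by (simp add: e_def dist_real_def abs_minus_commute)
    then show "s \<in> I" using e0 by blast
    then have "\<sigma> s \<in> S" using \<sigma>(1) by blast
    moreover have dist: "dist (\<sigma> s) p < min \<rho> (d / 3)"
      unfolding p_def using s by (intro e1(2)) (simp add: e_def dist_real_def)
    ultimately show "\<sigma> s \<in> S \<inter> ball p \<rho>" by (simp add: dist_commute)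
    show "3 * norm (\<sigma> s - p) < d" using dist by (simp add: dist_norm)
    show "\<sigma> s \<noteq> p"
    proof
      assume "\<sigma> s = p"
      then have "norm ((s - t) *\<^sub>R a) \<le> norm a / 2 * norm (s - t)"
        using e2(2)[of s] s by (simp add: p_def e_def)
      moreover have "0 < \<bar>s - t\<bar> * norm a" using s a0 by simp
      ultimately show False by (simp add: mult.commute)
    qed
  qed
  have pp: "p \<in> S \<inter> ball p \<rho>" using p \<rho> by simp
  have "\<exists>c1 c2. (s1, s2, c1, c2) \<in> inscribed_V_lines S n I \<sigma> t \<and> arc_len c1 < d \<and> arc_len c2 < d"
    if s1: "s1 \<in> {t - e<..<t}" and s2: "s2 \<in> {t<..<t + e}" for s1 s2
  proof -
    have n1: "s1 \<in> I \<and> \<sigma> s1 \<in> S \<inter> ball p \<rho> \<and> 3 * norm (\<sigma> s1 - p) < d \<and> \<sigma> s1 \<noteq> p"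
      by (rule near) (use s1 in auto)
    have n2: "s2 \<in> I \<and> \<sigma> s2 \<in> S \<inter> ball p \<rho> \<and> 3 * norm (\<sigma> s2 - p) < d \<and> \<sigma> s2 \<noteq> p"
      by (rule near) (use s2 in auto)
    obtain c1 where c1: "geodesic_arc S n c1" "c1 0 = \<sigma> s1" "c1 1 = p" "arc_len c1 \<le> 3 * norm (p - \<sigma> s1)"
      using geo[rule_format, of "\<sigma> s1" p] n1 pp by metis
    obtain c2 where c2: "geodesic_arc S n c2" "c2 0 = p" "c2 1 = \<sigma> s2" "arc_len c2 \<le> 3 * norm (\<sigma> s2 - p)"
      using geo[rule_format, of p "\<sigma> s2"] n2 pp by metis
    have "arc_len c1 < d" "arc_len c2 < d"
      using c1(4) c2(4) n1 n2 by (simp_all add: norm_minus_commute)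
    moreover have "(s1, s2, c1, c2) \<in> inscribed_V_lines S n I \<sigma> t"
      using c1 c2 n1 n2 s1 s2 by (simp add: inscribed_V_lines_def geodesic_V_line_def p_def)
    ultimately show ?thesis by blast
  qed
  then show ?thesis using e by blast
qed

lemma velocity_orthogonal_to_gauss_map:
  fixes S :: "(real^3) set" and n :: "real^3 \<Rightarrow> real^3" and I :: "real set" and \<sigma> :: "real \<Rightarrow> real^3" and t :: real
  assumes n: "gauss_map S n" and I: "open I" "is_interval I"
    and \<sigma>: "\<sigma> ` I \<subseteq> S" "regular_C2_curve I \<sigma>" and t: "t \<in> I"
  shows "n (\<sigma> t) \<bullet> velocity I \<sigma> t = 0"
proof -
  obtain e where e: "0 < e" "ball t e \<subseteq> I" using openE[OF I(1) t] .
  have d\<sigma>: "(\<sigma> has_vector_derivative velocity I \<sigma> t) (at (t + 0))"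
    using open_curve_derivatives(1)[OF I \<sigma>(2) t] by simp
  have "((\<lambda>s. t + s) has_real_derivative 1) (at 0)" by (auto intro!: derivative_eq_intros)
  then have "((\<lambda>s. \<sigma> (t + s)) has_vector_derivative velocity I \<sigma> t) (at 0)"
    using vector_diff_chain_at[of "\<lambda>s. t + s" 1 0 \<sigma> "velocity I \<sigma> t"] d\<sigma>
    by (simp add: comp_def has_real_derivative_iff_has_vector_derivative)
  moreover have "(\<lambda>s. \<sigma> (t + s)) ` {-e<..<e} \<subseteq> S"
  proof (rule image_subsetI)
    fix s assume "s \<in> {-e<..<e}"
    then have "t + s \<in> I" using e by (intro subsetD[OF e(2)]) (auto simp: dist_real_def)
    then show "\<sigma> (t + s) \<in> S" using \<sigma>(1) by blast
  qed
  ultimately have "e > 0 \<and> (\<lambda>s. \<sigma> (t + s)) ` {-e<..<e} \<subseteq> S \<and> (\<lambda>s. \<sigma> (t + s)) 0 = \<sigma> t \<and>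
      ((\<lambda>s. \<sigma> (t + s)) has_vector_derivative velocity I \<sigma> t) (at 0)"
    using e(1) by simp
  then have tan: "velocity I \<sigma> t \<in> tangent_space S (\<sigma> t)"
    unfolding tangent_space_def by blast
  have "\<sigma> t \<in> S" using \<sigma>(1) t by blast
  from bspec[OF conjunct2[OF n[unfolded gauss_map_def]] this] show ?thesis using tan by blast
qed

text \<open>With \<open>h1 = t - s1\<close> and \<open>h2 = s2 - t\<close>, the velocities \<open>w1\<close> and \<open>w2\<close> of the two geodesics at the
  vertex agree to second order with the tangential parts \<open>q1\<close> and \<open>q2\<close> of the chords. The Taylor
  expansion of the curve, projected to the tangent plane by \<open>T\<close>, turns this into
  \<open>w1 = h1 a - h1\<^sup>2 (T b) / 2 + o(h1\<^sup>2)\<close> and \<open>w2 = h2 a + h2\<^sup>2 (T b) / 2 + o(h2\<^sup>2)\<close>. These are the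
  hypotheses under which the limit of the quotient of angle and length has been computed.\<close>

lemma discrete_geodesic_curvature_limit:
  fixes S :: "(real^3) set" and n :: "real^3 \<Rightarrow> real^3" and I :: "real set" and \<sigma> :: "real \<Rightarrow> real^3" and t :: real
  assumes S: "smooth_surface S" and n: "gauss_map S n" and I: "open I" "is_interval I"
    and \<sigma>: "\<sigma> ` I \<subseteq> S" "regular_C2_curve I \<sigma>" and t: "t \<in> I"
  shows "((\<lambda>(s1, s2, c1, c2). discrete_geodesic_curvature n c1 c2) \<longlongrightarrow> geodesic_curvature n I \<sigma> t)
            (shrinking_V_lines S n I \<sigma> t)"
proof -
  define \<F> where "\<F> = shrinking_V_lines S n I \<sigma> t"
  define m where "m = n (\<sigma> t)"
  define a where "a = velocity I \<sigma> t"
  define b where "b = velocity I (velocity I \<sigma>) t"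
  define T where "T = tangential m"
  define s1 where "s1 = (\<lambda>x :: real \<times> real \<times> (real \<Rightarrow> real^3) \<times> (real \<Rightarrow> real^3). fst x)"
  define s2 where "s2 = (\<lambda>x :: real \<times> real \<times> (real \<Rightarrow> real^3) \<times> (real \<Rightarrow> real^3). fst (snd x))"
  define c1 where "c1 = (\<lambda>x :: real \<times> real \<times> (real \<Rightarrow> real^3) \<times> (real \<Rightarrow> real^3). fst (snd (snd x)))"
  define c2 where "c2 = (\<lambda>x :: real \<times> real \<times> (real \<Rightarrow> real^3) \<times> (real \<Rightarrow> real^3). snd (snd (snd x)))"
  define w1 where "w1 x = velocity {0..1} (c1 x) 1" for x
  define w2 where "w2 x = velocity {0..1} (c2 x) 0" for x
  define h1 where "h1 x = t - s1 x" for x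
  define h2 where "h2 x = s2 x - t" for x
  define q1 where "q1 x = T (\<sigma> t - \<sigma> (s1 x))" for x
  define q2 where "q2 x = T (\<sigma> (s2 x) - \<sigma> t)" for x
  have pS: "\<sigma> t \<in> S" using \<sigma>(1) t by blast
  have m1: "norm m = 1" unfolding m_def using bspec[OF conjunct2[OF n[unfolded gauss_map_def]] pS] by blast
  have ma: "m \<bullet> a = 0"
    unfolding m_def a_def by (rule velocity_orthogonal_to_gauss_map[OF n I \<sigma> t])
  have a0: "a \<noteq> 0" unfolding a_def by (rule regular_C2_curveD(3)[OF \<sigma>(2) t])
  have inscribed: "\<forall>\<^sub>F x in \<F>. s1 x < t \<and> t < s2 x \<and> geodesic_V_line S n (\<sigma> (s1 x)) (\<sigma> t) (\<sigma> (s2 x)) (c1 x) (c2 x)"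
    unfolding \<F>_def shrinking_V_lines_def
    by (rule filter_leD[OF inf_le2])
       (auto simp: eventually_principal inscribed_V_lines_def s1_def s2_def c1_def c2_def)
  have "filterlim (\<lambda>(s1, s2, c1, c2). (s1, s2, arc_len c1, arc_len c2)) (nhds (t, t, 0, 0)) \<F>"
    unfolding \<F>_def shrinking_V_lines_def
    by (rule filterlim_mono[OF filterlim_filtercomap order_refl inf_le1])
  then have lim: "((\<lambda>x. (s1 x, s2 x, arc_len (c1 x), arc_len (c2 x))) \<longlongrightarrow> (t, t, 0, 0)) \<F>"
    by (simp add: s1_def s2_def c1_def c2_def case_prod_unfold)
  have s1: "(s1 \<longlongrightarrow> t) \<F>" using tendsto_fst[OF lim] by simp
  have s2: "(s2 \<longlongrightarrow> t) \<F>" using tendsto_fst[OF tendsto_snd[OF lim]] by simp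
  have l1: "((\<lambda>x. arc_len (c1 x)) \<longlongrightarrow> 0) \<F>" using tendsto_fst[OF tendsto_snd[OF tendsto_snd[OF lim]]] by simp
  have l2: "((\<lambda>x. arc_len (c2 x)) \<longlongrightarrow> 0) \<F>" using tendsto_snd[OF tendsto_snd[OF tendsto_snd[OF lim]]] by simp
  have h1: "(h1 \<longlongrightarrow> 0) \<F>"
    using tendsto_diff[OF tendsto_const[of t] s1] by (simp add: h1_def[abs_def])
  have h2: "(h2 \<longlongrightarrow> 0) \<F>"
    using tendsto_diff[OF s2 tendsto_const[of t]] by (simp add: h2_def[abs_def])
  have pos: "\<forall>\<^sub>F x in \<F>. 0 < h1 x \<and> 0 < h2 x"
    using inscribed by eventually_elim (simp add: h1_def h2_def)
  have pos1: "\<forall>\<^sub>F x in \<F>. 0 < h1 x" and pos2: "\<forall>\<^sub>F x in \<F>. 0 < h2 x"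
    using pos by (auto elim: eventually_mono)
  have chord: "\<forall>\<^sub>F x in \<F>.
      norm (w1 x) = arc_len (c1 x) \<and> m \<bullet> w1 x = 0 \<and> norm (q1 x - w1 x) \<le> \<epsilon> * (norm (w1 x))\<^sup>2 \<and>
      norm (w2 x) = arc_len (c2 x) \<and> m \<bullet> w2 x = 0 \<and> norm (q2 x - w2 x) \<le> \<epsilon> * (norm (w2 x))\<^sup>2"
    if \<epsilon>: "0 < \<epsilon>" for \<epsilon>
  proof -
    obtain d where d: "0 < d" and ch: "\<forall>c. \<forall>s\<in>{0..1}. geodesic_arc S n c \<longrightarrow> c s = \<sigma> t \<longrightarrow> arc_len c < d \<longrightarrow>
      norm (velocity {0..1} c s) = arc_len c \<and> n (\<sigma> t) \<bullet> velocity {0..1} c s = 0 \<and>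
      norm (tangential (n (\<sigma> t)) (c 1 - c 0) - velocity {0..1} c s) \<le> \<epsilon> * (arc_len c)\<^sup>2"
      using short_geodesic_chord[OF S n pS \<epsilon>] by (elim exE conjE) (rule that)
    show ?thesis
      using inscribed order_tendstoD(2)[OF l1 d] order_tendstoD(2)[OF l2 d]
    proof eventually_elim
      case (elim x)
      then have V: "geodesic_arc S n (c1 x)" "c1 x 0 = \<sigma> (s1 x)" "c1 x 1 = \<sigma> t"
        "geodesic_arc S n (c2 x)" "c2 x 0 = \<sigma> t" "c2 x 1 = \<sigma> (s2 x)"
        by (simp_all add: geodesic_V_line_def)
      have "norm (w1 x) = arc_len (c1 x) \<and> m \<bullet> w1 x = 0 \<and> norm (q1 x - w1 x) \<le> \<epsilon> * (arc_len (c1 x))\<^sup>2"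
        using ch[rule_format, of 1 "c1 x"] V(1-3) elim(2) by (simp add: w1_def q1_def T_def m_def)
      moreover have "norm (w2 x) = arc_len (c2 x) \<and> m \<bullet> w2 x = 0 \<and> norm (q2 x - w2 x) \<le> \<epsilon> * (arc_len (c2 x))\<^sup>2"
        using ch[rule_format, of 0 "c2 x"] V(4-6) elim(3) by (simp add: w2_def q2_def T_def m_def)
      ultimately show ?case by metis
    qed
  qed
  have norms: "\<forall>\<^sub>F x in \<F>. arc_len (c1 x) = norm (w1 x)" "\<forall>\<^sub>F x in \<F>. arc_len (c2 x) = norm (w2 x)"
    and orth: "\<forall>\<^sub>F x in \<F>. m \<bullet> w1 x = 0 \<and> m \<bullet> w2 x = 0"
    using chord[OF zero_less_one] by (auto elim: eventually_mono)
  have w1_0: "((\<lambda>x. norm (w1 x)) \<longlongrightarrow> 0) \<F>" by (rule Lim_transform_eventually[OF l1 norms(1)])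
  have w2_0: "((\<lambda>x. norm (w2 x)) \<longlongrightarrow> 0) \<F>" by (rule Lim_transform_eventually[OF l2 norms(2)])
  interpret T: bounded_linear T unfolding T_def by (rule tangential_linear)
  have Ta: "T a = a" unfolding T_def by (rule tangential_orthogonal[OF ma])
  have "((\<lambda>h. T ((\<sigma> (t + h) - \<sigma> t - h *\<^sub>R a) /\<^sub>R h\<^sup>2)) \<longlongrightarrow> T ((1/2) *\<^sub>R b)) (at 0)"
    unfolding a_def b_def by (rule T.tendsto[OF second_order_taylor[OF I \<sigma>(2) t]])
  then have taylor: "((\<lambda>h. (T (\<sigma> (t + h) - \<sigma> t) - h *\<^sub>R a) /\<^sub>R h\<^sup>2) \<longlongrightarrow> (1/2) *\<^sub>R T b) (at 0)"
    by (simp add: T.scaleR T.diff Ta)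
  have "filterlim h2 (at 0) \<F>"
    using pos2 by (intro filterlim_atI h2) (auto elim: eventually_mono)
  from filterlim_compose[OF taylor this]
  have q2: "((\<lambda>x. (q2 x - h2 x *\<^sub>R a) /\<^sub>R (h2 x)\<^sup>2) \<longlongrightarrow> (1/2) *\<^sub>R T b) \<F>"
    by (simp add: q2_def h2_def)
  have t_h1: "t - h1 x = s1 x" for x by (simp add: h1_def)
  have "((\<lambda>x. - h1 x) \<longlongrightarrow> 0) \<F>" using tendsto_minus[OF h1] by simp
  then have "filterlim (\<lambda>x. - h1 x) (at 0) \<F>"
    using pos1 by (intro filterlim_atI) (auto elim: eventually_mono)
  from tendsto_minus[OF filterlim_compose[OF taylor this]]
  have "((\<lambda>x. - ((T (\<sigma> (s1 x) - \<sigma> t) + h1 x *\<^sub>R a) /\<^sub>R (h1 x)\<^sup>2)) \<longlongrightarrow> - ((1/2) *\<^sub>R T b)) \<F>"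
    by (simp add: t_h1)
  moreover have "- ((T (\<sigma> (s1 x) - \<sigma> t) + h1 x *\<^sub>R a) /\<^sub>R (h1 x)\<^sup>2) = (q1 x - h1 x *\<^sub>R a) /\<^sub>R (h1 x)\<^sup>2" for x
  proof -
    have "q1 x = - T (\<sigma> (s1 x) - \<sigma> t)" unfolding q1_def T.neg[symmetric] by simp
    then show ?thesis by (simp add: scaleR_right_distrib scaleR_right_diff_distrib)
  qed
  ultimately have q1: "((\<lambda>x. (q1 x - h1 x *\<^sub>R a) /\<^sub>R (h1 x)\<^sup>2) \<longlongrightarrow> - ((1/2) *\<^sub>R T b)) \<F>"
    by simp
  have e1: "((\<lambda>x. (w1 x - h1 x *\<^sub>R a) /\<^sub>R (h1 x)\<^sup>2) \<longlongrightarrow> - ((1/2) *\<^sub>R T b)) \<F>"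
    by (rule second_order_expansion_transfer[OF pos1 h1 q1 w1_0])
       (rule eventually_mono[OF chord], assumption, blast)
  have e2: "((\<lambda>x. (w2 x - h2 x *\<^sub>R a) /\<^sub>R (h2 x)\<^sup>2) \<longlongrightarrow> (1/2) *\<^sub>R T b) \<F>"
    by (rule second_order_expansion_transfer[OF pos2 h2 q2 w2_0])
       (rule eventually_mono[OF chord], assumption, blast)
  have "T b \<bullet> cross3 m a = b \<bullet> cross3 m a"
    by (simp add: T_def tangential_def inner_diff_left dot_cross_self)
  then have "2 * (((1/2) *\<^sub>R T b) \<bullet> cross3 m a) / norm a ^ 3 = geodesic_curvature n I \<sigma> t"
    unfolding geodesic_curvature_eq[OF I \<sigma>(2) t] a_def b_def m_def by simp
  with signed_angle_over_length_limit[OF m1 a0 orth pos h1 h2 e1 e2]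
  have "((\<lambda>x. 2 * signed_angle m (w1 x) (w2 x) / (norm (w1 x) + norm (w2 x)))
      \<longlongrightarrow> geodesic_curvature n I \<sigma> t) \<F>" by simp
  moreover have "\<forall>\<^sub>F x in \<F>. 2 * signed_angle m (w1 x) (w2 x) / (norm (w1 x) + norm (w2 x))
      = (case x of (s1, s2, c1, c2) \<Rightarrow> discrete_geodesic_curvature n c1 c2)"
    using inscribed norms
  proof eventually_elim
    case (elim x)
    then have "c1 x 1 = \<sigma> t" by (simp add: geodesic_V_line_def)
    then have "2 * signed_angle m (w1 x) (w2 x) / (norm (w1 x) + norm (w2 x))
        = discrete_geodesic_curvature n (c1 x) (c2 x)"
      using elim(2,3) by (simp add: discrete_geodesic_curvature_def m_def w1_def w2_def)
    then show ?case by (simp add: c1_def c2_def case_prod_unfold)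
  qed
  ultimately show ?thesis unfolding \<F>_def by (rule Lim_transform_eventually)
qed

theorem theorem2p1:
  fixes S :: "(real^3) set" and n :: "real^3 \<Rightarrow> real^3"
    and I :: "real set" and \<sigma> :: "real \<Rightarrow> real^3" and t :: real
  assumes "smooth_surface S" and "gauss_map S n"
    and "open I" and "is_interval I"
    and "\<sigma> ` I \<subseteq> S" and "regular_C2_curve I \<sigma>"
    and "t \<in> I"
  shows "(\<forall>d>0. \<exists>e>0. \<forall>s1\<in>{t - e<..<t}. \<forall>s2\<in>{t<..<t + e}. \<exists>c1 c2.
            (s1, s2, c1, c2) \<in> inscribed_V_lines S n I \<sigma> t \<and> arc_len c1 < d \<and> arc_len c2 < d) \<and>
         ((\<lambda>(s1, s2, c1, c2). discrete_geodesic_curvature n c1 c2) \<longlongrightarrow> geodesic_curvature n I \<sigma> t)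
            (shrinking_V_lines S n I \<sigma> t)"
  using short_inscribed_V_lines_exist[OF assms] discrete_geodesic_curvature_limit[OF assms] by blast

end
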